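(* Let $\zeta_1,\zeta_2,\kappa_1,\kappa_2,\sigma>0$ and $\gamma\in(0,1)$. For sufficiently small step size $\tau>0$, the discrete random dynamical system $\varphi^\tau$ generated by the numerical method described in the context possesses a random attractor $A^\tau(\omega)$.
   Context: **Noise.** $\Omega=C_0(\mathbb R;\mathbb R)$ is the space of continuous $\omega:\mathbb R\to\mathbb R$ with $\omega(0)=0$, $\mathcal F$ its Borel $\sigma$-algebra, $\mathbb P$ Wiener measure, $\theta_t\omega(\cdot)=\omega(t+\cdot)-\omega(t)$, $W(t,\omega)=\omega(t)$ (two-sided Brownian motion). $\Omega$ is restricted to a $\theta$-invariant set of full measure on which the almost sure growth and ergodic properties of $\omega$ and of the stationary Ornstein–Uhlenbeck process $z(\theta_t\omega)=\sigma\int_{-\infty}^0e^{\alpha s}\mathrm d(\theta_t\omega)(s)$ ($\alpha>0$) hold. **Numerical method.** Step size $\tau>0$, $t_k=k\tau$, $\Delta W_k=W(t_{k+1})-W(t_k)$. Given $\bar{\bm V}_k=(\bar V_k,\bar{\mathcal V}_k,\bar U_k,\bar{\mathcal U}_k)^\top$ and $\bar S_k=(1-\gamma\sin^2\bar U_k)^{-1/2}$, the next iterate $\bar{\bm V}_{k+1}$ is the unique solution of the (linearly implicit) system $$\begin{aligned}\bar V_{k+1}&=\bar V_k+\tau\bar{\mathcal V}_{k+1}+\tau\gamma\bar S_k\bar{\mathcal U}_{k+1}\sin\bar U_k,\\ \bar{\mathcal V}_{k+1}&=\bar{\mathcal V}_k-\tau\kappa_1\bar V_{k+1}-2\tau\zeta_1\bar{\mathcal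 V}_{k+1}-2\tau\zeta_1\gamma\bar S_k\bar{\mathcal U}_{k+1}\sin\bar U_k+\sigma\Delta W_k,\\ \bar U_{k+1}&=\bar U_k+\tau\bar S_k\bar{\mathcal U}_{k+1},\\ \bar{\mathcal U}_{k+1}&=\bar{\mathcal U}_k-2\tau\bar S_k^2(\zeta_2+\zeta_1\gamma\sin^2\bar U_k)\bar{\mathcal U}_{k+1}-\tau\bar S_k(\kappa_2+2\zeta_1\bar{\mathcal V}_{k+1}+\kappa_1\bar V_{k+1})\sin\bar U_k+\sigma\bar S_k\sin\bar U_k\,\Delta W_k.\end{aligned}$$ The third (angle) coordinate is always understood modulo $2\pi$ with representative in $[0,2\pi)$; the state space "$\mathbb R^4$" is understood as $\mathcal N=\mathbb R^2\times\mathbb R/(2\pi\mathbb Z)\times\mathbb R$ in this sense. **Discrete RDS.** For $k\in\mathbb Z_{\ge0}$ let $\bar\varphi^\tau(k,\omega,\bm y)$ be $\bar{\bm V}_k$ started from $\bar{\bm V}_0=\bm y$ with noise path $\omega$; it satisfies the cocycle property $\bar\varphi^\tau(k+j,\omega,\cdot)=\bar\varphi^\tau(k,\theta_{j\tau}\omega,\cdot)\circ\bar\varphi^\tau(j,\omega,\cdot)$ for $k,j\ge0$. Define the diffeomorphism $$\mathcal J(x_1,x_2,x_3,x_4)=\Big(x_1,\;x_2+\gamma x_4\sin x_3(1-\gamma\sin^2x_3)^{-1/2},\;x_3,\;x_4(1-\gamma\sin^2x_3)^{-1/2}\Big)^\top$$ and $\varphi^\tau(k,\omega,\bm x)=\mathcal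 J\big(\bar\varphi^\tau(k,\omega,\mathcal J^{-1}(\bm x))\big)$, $k\ge0$. This is a (forward-time) discrete RDS over $(\Omega,\mathcal F,\mathbb P,\theta)$. **Random attractor.** A random set $D$ is tempered if $D(\omega)\subset B_{\rho(\omega)}(0)$ for all $\omega$, with $\rho$ a random variable satisfying $\lim_{t\to\infty}\frac1t\log^+\rho(\theta_{-t}\omega)=0$; $\mathcal D$ is the family of compact tempered random sets. $A^\tau\in\mathcal D$ is a random attractor for $\varphi^\tau$ if $\varphi^\tau(k,\omega,A^\tau(\omega))=A^\tau(\theta_{k\tau}\omega)$ for all integers $k\geq 1$ and $\omega\in\Omega$, and for every $D\in\mathcal D$ and all $\omega\in\Omega$, $\lim_{k\to\infty}d\big(\varphi^\tau(k,\theta_{-k\tau}\omega,D(\theta_{-k\tau}\omega)),A^\tau(\omega)\big)=0$, where $d(B_1,B_2)=\sup_{x\in B_1}\inf_{y\in B_2}\|x-y\|$ (topology and distance being those of $\mathcal N$). *)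

theory Defs
  imports "HOL-Probability.Probability" "HOL-Library.Real_Mod"
begin

section \<open>The state space\<close>

text \<open>The circle of reals modulo $2\pi$, each class being given by its representative in
  $[0,2\pi)$, with the quotient (arc length) distance.\<close>

typedef angle = "{0..<2 * pi}"
  morphisms rep_angle Abs_angle
  by (intro exI[of _ 0]) simp

definition angle_of :: "real \<Rightarrow> angle" where
  "angle_of x = Abs_angle (x rmod (2 * pi))"

instantiation angle :: metric_space
begin

definition dist_angle :: "angle \<Rightarrow> angle \<Rightarrow> real" where
  "dist_angle u v =
     min \<bar>rep_angle u - rep_angle v\<bar> (2 * pi - \<bar>rep_angle u - rep_angle v\<bar>)"

definition uniformity_angle :: "(angle \<times> angle) filter" where
  "uniformity_angle = (INF e\<in>{0<..}. principal {(x, y). dist x y < e})"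

definition open_angle :: "angle set \<Rightarrow> bool" where
  "open_angle U \<longleftrightarrow> (\<forall>x\<in>U. \<forall>\<^sub>F (x', y) in uniformity. x' = x \<longrightarrow> y \<in> U)"

instance
proof
  fix u v w :: angle
  have b: "0 \<le> rep_angle x" "rep_angle x < 2 * pi" for x
    using rep_angle[of x] by auto
  show "dist u v = 0 \<longleftrightarrow> u = v"
    using b[of u] b[of v] by (auto simp: dist_angle_def min_def rep_angle_inject abs_if)
  show "dist u v \<le> dist u w + dist v w"
    using b[of u] b[of v] b[of w] unfolding dist_angle_def min_def abs_if by (auto split: if_splits)
qed (simp_all add: uniformity_angle_def open_angle_def)

end

text \<open>The Euclidean product distance of the library is the distance of $\mathcal N$.\<close>

type_synonym state = "real \<times> real \<times> angle \<times> real"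

definition origin :: state where
  "origin = (0, 0, angle_of 0, 0)"

text \<open>$d(B_1,B_2)$; the extended reals make the supremum meaningful for every pair of sets.\<close>

definition semidist :: "'a::metric_space set \<Rightarrow> 'a set \<Rightarrow> ereal" where
  "semidist B1 B2 = (SUP x\<in>B1. INF y\<in>B2. ereal (dist x y))"


section \<open>The noise\<close>

type_synonym path = "real \<Rightarrow> real"

definition C0 :: "path set" where
  "C0 = {\<omega>. continuous_on UNIV \<omega> \<and> \<omega> 0 = 0}"

text \<open>The compact-open topology on \<^const>\<open>C0\<close> and its Borel sigma-algebra.\<close>

definition path_topology :: "path topology" where
  "path_topology =
     topology_generated_by {{\<omega> \<in> C0. \<omega> ` K \<subseteq> U} | K U. compact K \<and> open U}"

definition path_borel :: "path measure" where
  "path_borel = sigma C0 {U. openin path_topology U}"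

text \<open>Two-sided Wiener measure: independent increments over consecutive intervals of the whole
  line, and increments over $[s,t]$ that are centred normal with variance $t-s$. This determines
  the measure uniquely.\<close>

definition wiener_measure :: "path measure \<Rightarrow> bool" where
  "wiener_measure P \<longleftrightarrow>
     prob_space P \<and> space P = C0 \<and> sets P = sets path_borel \<and>
     (\<forall>s t. s < t \<longrightarrow>
        distributed P lborel (\<lambda>\<omega>. \<omega> t - \<omega> s) (\<lambda>x. ennreal (normal_density 0 (sqrt (t - s)) x))) \<and>
     (\<forall>(n::nat) (t :: nat \<Rightarrow> real). strict_mono_on {..n} t \<longrightarrow>
        prob_space.indep_vars P (\<lambda>_. borel) (\<lambda>i \<omega>. \<omega> (t (Suc i)) - \<omega> (t i)) {..<n})"

definition shift :: "real \<Rightarrow> path \<Rightarrow> path" where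
  "shift t \<omega> = (\<lambda>s. \<omega> (t + s) - \<omega> t)"

text \<open>The stationary Ornstein--Uhlenbeck variable
  $z(\omega)=\sigma\int_{-\infty}^0 e^{\alpha s}\,\mathrm d\omega(s)$, defined pathwise by
  integration by parts; the boundary terms vanish since $\omega(0)=0$ and $\omega$ grows
  sublinearly.\<close>

definition ou :: "real \<Rightarrow> real \<Rightarrow> path \<Rightarrow> real" where
  "ou \<alpha> \<sigma> \<omega> = - \<sigma> * \<alpha> * (LBINT s=-\<infinity>..0. exp (\<alpha> * s) * \<omega> s)"

text \<open>The almost sure properties: sublinear growth of $\omega$ and of
  $t\mapsto z(\theta_t\omega)$, and the ergodic theorem for $z$ and its absolute moments.\<close>

definition good_path :: "path measure \<Rightarrow> real \<Rightarrow> real \<Rightarrow> path \<Rightarrow> bool" where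
  "good_path P \<alpha> \<sigma> \<omega> \<longleftrightarrow>
     (\<forall>F \<in> {at_top, at_bot}.
        ((\<lambda>t. \<omega> t / t) \<longlongrightarrow> 0) F \<and>
        ((\<lambda>t. ou \<alpha> \<sigma> (shift t \<omega>) / t) \<longlongrightarrow> 0) F \<and>
        ((\<lambda>t. (1 / t) * (LBINT s=0..t. ou \<alpha> \<sigma> (shift s \<omega>))) \<longlongrightarrow> 0) F \<and>
        (\<forall>m::nat. ((\<lambda>t. (1 / t) * (LBINT s=0..t. \<bar>ou \<alpha> \<sigma> (shift s \<omega>)\<bar> ^ m))
                    \<longlongrightarrow> (\<integral>\<eta>. \<bar>ou \<alpha> \<sigma> \<eta>\<bar> ^ m \<partial>P)) F))"

text \<open>The sets to which $\Omega$ may be restricted.\<close>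

definition admissible_paths :: "path measure \<Rightarrow> real \<Rightarrow> real \<Rightarrow> path set \<Rightarrow> bool" where
  "admissible_paths P \<alpha> \<sigma> \<Omega> \<longleftrightarrow>
     \<Omega> \<in> sets P \<and> measure P \<Omega> = 1 \<and> (\<forall>t. shift t ` \<Omega> = \<Omega>) \<and>
     (\<forall>\<omega>\<in>\<Omega>. good_path P \<alpha> \<sigma> \<omega>)"


section \<open>The numerical method and its random dynamical system\<close>

definition S_fun :: "real \<Rightarrow> real \<Rightarrow> real" where
  "S_fun \<gamma> u = (1 - \<gamma> * (sin u)\<^sup>2) powr (- (1/2))"

text \<open>The state \<open>(V', P', U', Q')\<close> solves the linearly implicit system for the old state
  \<open>(V, P, U, Q)\<close>, where \<open>P\<close>, \<open>Q\<close> are the velocity variables $\mathcal V$, $\mathcal U$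
  and \<open>dW\<close> is the Wiener increment.\<close>

definition scheme_eqs ::
  "real \<Rightarrow> real \<Rightarrow> real \<Rightarrow> real \<Rightarrow> real \<Rightarrow> real \<Rightarrow> real \<Rightarrow> real \<Rightarrow> state \<Rightarrow> state \<Rightarrow> bool" where
  "scheme_eqs \<zeta>\<^sub>1 \<zeta>\<^sub>2 \<kappa>\<^sub>1 \<kappa>\<^sub>2 \<gamma> \<sigma> \<tau> dW = (\<lambda>(V, P, U, Q) (V', P', U', Q').
     let u = rep_angle U; S = S_fun \<gamma> u in
       V' = V + \<tau> * P' + \<tau> * \<gamma> * S * Q' * sin u \<and>
       P' = P - \<tau> * \<kappa>\<^sub>1 * V' - 2 * \<tau> * \<zeta>\<^sub>1 * P' - 2 * \<tau> * \<zeta>\<^sub>1 * \<gamma> * S * Q' * sin u + \<sigma> * dW \<and>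
       U' = angle_of (u + \<tau> * S * Q') \<and>
       Q' = Q - 2 * \<tau> * S\<^sup>2 * (\<zeta>\<^sub>2 + \<zeta>\<^sub>1 * \<gamma> * (sin u)\<^sup>2) * Q'
              - \<tau> * S * (\<kappa>\<^sub>2 + 2 * \<zeta>\<^sub>1 * P' + \<kappa>\<^sub>1 * V') * sin u + \<sigma> * S * sin u * dW)"

definition scheme_step ::
  "real \<Rightarrow> real \<Rightarrow> real \<Rightarrow> real \<Rightarrow> real \<Rightarrow> real \<Rightarrow> real \<Rightarrow> real \<Rightarrow> state \<Rightarrow> state" where
  "scheme_step \<zeta>\<^sub>1 \<zeta>\<^sub>2 \<kappa>\<^sub>1 \<kappa>\<^sub>2 \<gamma> \<sigma> \<tau> dW y = (THE y'. scheme_eqs \<zeta>\<^sub>1 \<zeta>\<^sub>2 \<kappa>\<^sub>1 \<kappa>\<^sub>2 \<gamma> \<sigma> \<tau> dW y y')"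

primrec phi_bar ::
  "real \<Rightarrow> real \<Rightarrow> real \<Rightarrow> real \<Rightarrow> real \<Rightarrow> real \<Rightarrow> real \<Rightarrow> nat \<Rightarrow> path \<Rightarrow> state \<Rightarrow> state" where
  "phi_bar \<zeta>\<^sub>1 \<zeta>\<^sub>2 \<kappa>\<^sub>1 \<kappa>\<^sub>2 \<gamma> \<sigma> \<tau> 0 \<omega> y = y"
| "phi_bar \<zeta>\<^sub>1 \<zeta>\<^sub>2 \<kappa>\<^sub>1 \<kappa>\<^sub>2 \<gamma> \<sigma> \<tau> (Suc k) \<omega> y =
     scheme_step \<zeta>\<^sub>1 \<zeta>\<^sub>2 \<kappa>\<^sub>1 \<kappa>\<^sub>2 \<gamma> \<sigma> \<tau> (\<omega> (real (Suc k) * \<tau>) - \<omega> (real k * \<tau>))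
       (phi_bar \<zeta>\<^sub>1 \<zeta>\<^sub>2 \<kappa>\<^sub>1 \<kappa>\<^sub>2 \<gamma> \<sigma> \<tau> k \<omega> y)"

definition J_map :: "real \<Rightarrow> state \<Rightarrow> state" where
  "J_map \<gamma> = (\<lambda>(x1, x2, x3, x4).
     let u = rep_angle x3 in
       (x1, x2 + \<gamma> * x4 * sin u * S_fun \<gamma> u, x3, x4 * S_fun \<gamma> u))"

definition phi ::
  "real \<Rightarrow> real \<Rightarrow> real \<Rightarrow> real \<Rightarrow> real \<Rightarrow> real \<Rightarrow> real \<Rightarrow> nat \<Rightarrow> path \<Rightarrow> state \<Rightarrow> state" where
  "phi \<zeta>\<^sub>1 \<zeta>\<^sub>2 \<kappa>\<^sub>1 \<kappa>\<^sub>2 \<gamma> \<sigma> \<tau> k \<omega> x =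
     J_map \<gamma> (phi_bar \<zeta>\<^sub>1 \<zeta>\<^sub>2 \<kappa>\<^sub>1 \<kappa>\<^sub>2 \<gamma> \<sigma> \<tau> k \<omega> (inv (J_map \<gamma>) x))"


section \<open>Random attractors\<close>

text \<open>In the following, \<open>M\<close> is the probability space of the restricted paths. A compact random
  set has nonempty compact values whose distance from every fixed point is a random variable.\<close>

definition compact_random_set :: "path measure \<Rightarrow> (path \<Rightarrow> state set) \<Rightarrow> bool" where
  "compact_random_set M D \<longleftrightarrow>
     (\<forall>\<omega>\<in>space M. compact (D \<omega>) \<and> D \<omega> \<noteq> {}) \<and>
     (\<forall>x. (\<lambda>\<omega>. infdist x (D \<omega>)) \<in> borel_measurable M)"

text \<open>Here \<open>ln (max 1 r)\<close> is $\log^+ r$.\<close>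

definition tempered :: "path measure \<Rightarrow> (path \<Rightarrow> state set) \<Rightarrow> bool" where
  "tempered M D \<longleftrightarrow>
     (\<exists>\<rho> \<in> borel_measurable M.
        (\<forall>\<omega>\<in>space M. D \<omega> \<subseteq> ball origin (\<rho> \<omega>)) \<and>
        (\<forall>\<omega>\<in>space M. ((\<lambda>t. (1 / t) * ln (max 1 (\<rho> (shift (- t) \<omega>)))) \<longlongrightarrow> (0::real)) at_top))"

definition tempered_sets :: "path measure \<Rightarrow> (path \<Rightarrow> state set) set" where
  "tempered_sets M = {D. compact_random_set M D \<and> tempered M D}"

definition random_attractor ::
  "path measure \<Rightarrow> real \<Rightarrow> (nat \<Rightarrow> path \<Rightarrow> state \<Rightarrow> state) \<Rightarrow> (path \<Rightarrow> state set) \<Rightarrow> bool" where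
  "random_attractor M \<tau> \<phi> A \<longleftrightarrow>
     A \<in> tempered_sets M \<and>
     (\<forall>k\<ge>1. \<forall>\<omega>\<in>space M. \<phi> k \<omega> ` A \<omega> = A (shift (real k * \<tau>) \<omega>)) \<and>
     (\<forall>D\<in>tempered_sets M. \<forall>\<omega>\<in>space M.
        (\<lambda>k. semidist (\<phi> k (shift (- (real k * \<tau>)) \<omega>) ` D (shift (- (real k * \<tau>)) \<omega>)) (A \<omega>))
          \<longlonglongrightarrow> 0)"

end

theory Submission
  imports Defs "HOL-Real_Asymp.Real_Asymp"
begin

text \<open>
  The damping makes the scheme dissipative path by path, and a discrete random dynamical system that
  has compact, forward invariant and absorbing random sets has a random attractor: the intersection of
  the images, at the present time, of the absorbing sets of the past (\<open>dissipative_cocycle\<close>). All the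
  analysis therefore goes into one energy estimate and into the random radius that it produces.

  Unrolling the angle turns a step of the scheme into an explicit continuous map \<open>lift_step\<close> of a
  Euclidean space (\<open>scheme_step_cover\<close>). In the variables of the scheme the kinetic energy is diagonal,
  and since the method is implicit, the discrete energy balance is as good as that of the continuous
  system (\<open>energy_balance\<close>): friction dissipates both velocities, and the numerical error only helps.
  The position \<open>V\<close> is not damped directly; adding a small multiple of the product of position and
  momentum to the energy makes it dissipate as well. The result is the recursion
  \<open>energy (lift_step d z) \<le> decay * (energy z + forcing d)\<close> with \<open>decay < 1\<close> and a forcing that is
  quadratic in the Wiener increment \<open>d\<close> (\<open>energy_lift_step_le\<close>).

  Summing the discounted forcing over the past gives the stationary solution \<open>radius\<close> of this recursion.
  The paths grow sublinearly, so the increments grow at most linearly towards the past; hence the series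
  converges and the radius grows at most quadratically along the backward shifts (\<open>radius_growth\<close>), which
  is more than temperedness asks for. The sublevel sets of the energy at level \<open>radius + 1\<close> are forward
  invariant, and they absorb every tempered set because the geometric decay beats subexponential growth
  (\<open>absorbing_pullback\<close>).

  It remains to see that the attractor is a random set. Its distance from a point is the supremum of the
  distances from the decreasing pullback sets, and each of these is the image of one fixed
  set under a map that is continuous in the point and measurable in the path
  (\<open>measurable_infdist_pullback\<close>).
\<close>

section \<open>Decreasing sequences of compact sets\<close>

text \<open>The sets \<open>- K n\<close> form an increasing open cover of the compact set \<open>K 0 - U\<close>, so one of
  them already covers it.\<close>

lemma decseq_compact_subset_open:
  fixes K :: "nat \<Rightarrow> 'a::t2_space set"
  assumes compact: "\<And>n. compact (K n)" and "decseq K" and "open U" and sub: "(\<Inter>n. K n) \<subseteq> U"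
  shows "\<exists>n. K n \<subseteq> U"
proof -
  have cpt: "compact (K 0 - U)"
    using compact[of 0] \<open>open U\<close> by (rule compact_diff)
  have op: "open (- K n)" for n
    using compact_imp_closed[OF compact[of n]] by (rule open_Compl)
  have "K 0 - U \<subseteq> (\<Union>n\<in>UNIV. - K n)"
    using sub by auto
  from compactE_image[OF cpt op this]
  obtain C where C: "finite C" "K 0 - U \<subseteq> (\<Union>n\<in>C. - K n)"
    by metis
  from C(1) obtain N where N: "\<forall>n\<in>C. n \<le> N"
    using finite_nat_set_iff_bounded_le by blast
  have "K N \<subseteq> K 0" and "\<And>n. n \<in> C \<Longrightarrow> K N \<subseteq> K n"
    using \<open>decseq K\<close> N by (auto simp: decseq_def)
  then have "K N \<subseteq> U"
    using C(2) by blast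
  then show ?thesis ..
qed

lemma decseq_compact_Inter_nonempty:
  fixes K :: "nat \<Rightarrow> 'a::t2_space set"
  assumes "\<And>n. compact (K n)" "decseq K" "\<And>n. K n \<noteq> {}"
  shows "(\<Inter>n. K n) \<noteq> {}"
  using decseq_compact_subset_open[of K "{}"] assms by auto

lemma decseq_compact_image_Inter:
  fixes K :: "nat \<Rightarrow> 'a::t2_space set" and f :: "'a \<Rightarrow> 'b::t1_space"
  assumes compact: "\<And>n. compact (K n)" and "decseq K" and f: "continuous_on UNIV f"
  shows "f ` (\<Inter>n. K n) = (\<Inter>n. f ` K n)"
proof
  show "(\<Inter>n. f ` K n) \<subseteq> f ` (\<Inter>n. K n)"
  proof
    fix y assume y: "y \<in> (\<Inter>n. f ` K n)"
    have "closed (f -` {y})"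
      using f by (simp add: closed_vimage)
    then have "compact (K n \<inter> f -` {y})" for n
      using compact by (rule compact_Int_closed[rotated])
    moreover have "decseq (\<lambda>n. K n \<inter> f -` {y})"
      using \<open>decseq K\<close> by (fastforce simp: decseq_def)
    moreover have "K n \<inter> f -` {y} \<noteq> {}" for n
      using y by auto
    ultimately have "(\<Inter>n. K n \<inter> f -` {y}) \<noteq> {}"
      by (rule decseq_compact_Inter_nonempty)
    then show "y \<in> f ` (\<Inter>n. K n)"
      by auto
  qed
qed auto

text \<open>A point at distance at most \<open>c\<close> from each \<open>K n\<close> gives a decreasing sequence of nonempty
  compact sets \<open>K n \<inter> cball x c\<close>. The equivalence reduces measurability of the distance from the
  intersection to that of the countably many distances from the sets \<open>K n\<close>.\<close>

lemma infdist_decseq_compact_le_iff: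
  fixes K :: "nat \<Rightarrow> 'a::metric_space set"
  assumes compact: "\<And>n. compact (K n)" and "decseq K" and ne: "\<And>n. K n \<noteq> {}"
  shows "infdist x (\<Inter>n. K n) \<le> c \<longleftrightarrow> (\<forall>n. infdist x (K n) \<le> c)"
proof
  assume le: "infdist x (\<Inter>n. K n) \<le> c"
  show "\<forall>n. infdist x (K n) \<le> c"
  proof
    fix n
    have "infdist x (K n) \<le> infdist x (\<Inter>n. K n)"
      using decseq_compact_Inter_nonempty[OF assms] by (intro infdist_mono) auto
    with le show "infdist x (K n) \<le> c" by simp
  qed
next
  assume le: "\<forall>n. infdist x (K n) \<le> c"
  have "compact (K n \<inter> cball x c)" for n
    using compact by (intro compact_Int_closed) auto
  moreover have "decseq (\<lambda>n. K n \<inter> cball x c)"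
    using \<open>decseq K\<close> by (fastforce simp: decseq_def)
  moreover have "K n \<inter> cball x c \<noteq> {}" for n
  proof -
    obtain y where "y \<in> K n" "infdist x (K n) = dist x y"
      using setdist_attains_inf[OF compact ne, where A="{x}"]
      by (metis infdist_eq_setdist infdist_singleton dist_commute)
    then show ?thesis using le[rule_format, of n] by auto
  qed
  ultimately have "(\<Inter>n. K n \<inter> cball x c) \<noteq> {}"
    by (rule decseq_compact_Inter_nonempty)
  then obtain y where "y \<in> (\<Inter>n. K n)" "dist x y \<le> c"
    by auto
  then show "infdist x (\<Inter>n. K n) \<le> c"
    by (rule infdist_le2)
qed


section \<open>The attractor of a dissipative cocycle\<close>

text \<open>The group \<open>\<theta>\<close> shifts the noise by whole steps. The compact sets \<open>B \<omega>\<close> are mapped into one another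
  by the cocycle, so that starting the dynamics in \<open>B\<close> ever earlier in the past leaves a decreasing
  sequence of compact sets at the present. Their intersection attracts whatever \<open>B\<close> absorbs.\<close>

locale dissipative_cocycle =
  fixes \<Omega> :: "'w set" and \<theta> :: "int \<Rightarrow> 'w \<Rightarrow> 'w"
    and \<phi> :: "nat \<Rightarrow> 'w \<Rightarrow> 'a::metric_space \<Rightarrow> 'a"
    and B :: "'w \<Rightarrow> 'a set"
  assumes shift_closed: "\<omega> \<in> \<Omega> \<Longrightarrow> \<theta> i \<omega> \<in> \<Omega>"
    and shift_0: "\<omega> \<in> \<Omega> \<Longrightarrow> \<theta> 0 \<omega> = \<omega>"
    and shift_add: "\<theta> i (\<theta> i' \<omega>) = \<theta> (i + i') \<omega>"
    and cocycle_0: "\<phi> 0 \<omega> x = x"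
    and cocycle_add: "\<phi> (k + j) \<omega> x = \<phi> k (\<theta> (int j) \<omega>) (\<phi> j \<omega> x)"
    and continuous_cocycle: "continuous_on UNIV (\<phi> k \<omega>)"
    and compact_B: "\<omega> \<in> \<Omega> \<Longrightarrow> compact (B \<omega>)"
    and B_nonempty: "\<omega> \<in> \<Omega> \<Longrightarrow> B \<omega> \<noteq> {}"
    and B_forward: "\<omega> \<in> \<Omega> \<Longrightarrow> \<phi> (Suc 0) \<omega> ` B \<omega> \<subseteq> B (\<theta> 1 \<omega>)"
begin

definition pullback :: "nat \<Rightarrow> 'w \<Rightarrow> 'a set" where
  "pullback k \<omega> = \<phi> k (\<theta> (- int k) \<omega>) ` B (\<theta> (- int k) \<omega>)"

definition attractor :: "'w \<Rightarrow> 'a set" where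
  "attractor \<omega> = (\<Inter>k. pullback k \<omega>)"

lemma compact_pullback: "\<omega> \<in> \<Omega> \<Longrightarrow> compact (pullback k \<omega>)"
  unfolding pullback_def
  by (intro compact_continuous_image compact_B shift_closed
        continuous_on_subset[OF continuous_cocycle]) auto

lemma pullback_nonempty: "\<omega> \<in> \<Omega> \<Longrightarrow> pullback k \<omega> \<noteq> {}"
  unfolding pullback_def by (simp add: B_nonempty shift_closed)

lemma pullback_0: "\<omega> \<in> \<Omega> \<Longrightarrow> pullback 0 \<omega> = B \<omega>"
  unfolding pullback_def by (simp add: shift_0 cocycle_0)

lemma decseq_pullback:
  assumes "\<omega> \<in> \<Omega>"
  shows "decseq (\<lambda>k. pullback k \<omega>)"
proof (rule decseq_SucI)
  fix k
  let ?\<eta> = "\<theta> (- int (Suc k)) \<omega>"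
  have eq: "\<theta> 1 ?\<eta> = \<theta> (- int k) \<omega>"
    by (simp add: shift_add)
  have "pullback (Suc k) \<omega> = \<phi> k (\<theta> 1 ?\<eta>) ` \<phi> (Suc 0) ?\<eta> ` B ?\<eta>"
    using cocycle_add[of k "Suc 0" ?\<eta>] by (simp add: pullback_def image_image)
  also have "\<dots> \<subseteq> \<phi> k (\<theta> 1 ?\<eta>) ` B (\<theta> 1 ?\<eta>)"
    by (intro image_mono B_forward shift_closed assms)
  finally show "pullback (Suc k) \<omega> \<subseteq> pullback k \<omega>"
    unfolding eq by (simp add: pullback_def)
qed

lemma cocycle_image_pullback:
  assumes "\<omega> \<in> \<Omega>"
  shows "\<phi> k \<omega> ` pullback n \<omega> = pullback (k + n) (\<theta> (int k) \<omega>)"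
proof -
  let ?\<eta> = "\<theta> (- int n) \<omega>"
  have "\<phi> (k + n) ?\<eta> x = \<phi> k \<omega> (\<phi> n ?\<eta> x)" for x
    using cocycle_add[of k n ?\<eta>] by (simp add: shift_add shift_0 assms)
  then show ?thesis
    by (simp add: pullback_def shift_add image_image)
qed

lemma compact_attractor:
  assumes "\<omega> \<in> \<Omega>"
  shows "compact (attractor \<omega>)"
proof -
  have "closed (attractor \<omega>)"
    unfolding attractor_def
    by (intro closed_INT ballI compact_imp_closed compact_pullback assms)
  then have "compact (pullback 0 \<omega> \<inter> attractor \<omega>)"
    by (intro compact_Int_closed compact_pullback assms)
  also have "pullback 0 \<omega> \<inter> attractor \<omega> = attractor \<omega>"
    by (auto simp: attractor_def)
  finally show ?thesis .
qed

lemma attractor_nonempty: "\<omega> \<in> \<Omega> \<Longrightarrow> attractor \<omega> \<noteq> {}"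
  unfolding attractor_def
  by (intro decseq_compact_Inter_nonempty compact_pullback decseq_pullback pullback_nonempty)

lemma attractor_subset_B: "\<omega> \<in> \<Omega> \<Longrightarrow> attractor \<omega> \<subseteq> B \<omega>"
  using pullback_0 by (force simp: attractor_def)

text \<open>Applying the cocycle to the pullback sets only reindexes them, and it commutes with the intersection
  because they are nested and compact.\<close>

lemma attractor_invariant:
  assumes "\<omega> \<in> \<Omega>"
  shows "\<phi> k \<omega> ` attractor \<omega> = attractor (\<theta> (int k) \<omega>)"
proof -
  have dec: "decseq (\<lambda>n. pullback n (\<theta> (int k) \<omega>))"
    by (intro decseq_pullback shift_closed assms)
  have "\<phi> k \<omega> ` attractor \<omega> = (\<Inter>n. \<phi> k \<omega> ` pullback n \<omega>)"
    unfolding attractor_def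
    by (intro decseq_compact_image_Inter compact_pullback decseq_pullback continuous_cocycle assms)
  also have "\<dots> = (\<Inter>n. pullback (k + n) (\<theta> (int k) \<omega>))"
    by (simp add: cocycle_image_pullback assms)
  also have "\<dots> = (\<Inter>n. pullback n (\<theta> (int k) \<omega>))"
  proof (intro antisym INF_greatest)
    fix n
    show "(\<Inter>n. pullback (k + n) (\<theta> (int k) \<omega>)) \<subseteq> pullback n (\<theta> (int k) \<omega>)"
      using dec by (intro INF_lower2[of n]) (auto simp: decseq_def)
  qed (auto intro: INF_lower)
  finally show ?thesis by (simp add: attractor_def)
qed

text \<open>Some pullback set, say that of \<open>m\<close> steps, lies in the given neighbourhood of the attractor. Once \<open>D\<close>
  started far in the past has entered \<open>B\<close> by time \<open>-m\<close>, the remaining \<open>m\<close> steps carry it into that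
  pullback set.\<close>

lemma attractor_attracts:
  assumes \<omega>: "\<omega> \<in> \<Omega>" and ne: "\<And>k. D (\<theta> (- int k) \<omega>) \<noteq> {}"
    and absorbed: "\<And>\<eta>. \<eta> \<in> \<Omega> \<Longrightarrow>
      \<forall>\<^sub>F k in sequentially. \<phi> k (\<theta> (- int k) \<eta>) ` D (\<theta> (- int k) \<eta>) \<subseteq> B \<eta>"
  shows "(\<lambda>k. semidist (\<phi> k (\<theta> (- int k) \<omega>) ` D (\<theta> (- int k) \<omega>)) (attractor \<omega>)) \<longlonglongrightarrow> 0"
proof (rule order_tendstoI)
  fix a :: ereal assume "a < 0"
  have "0 \<le> semidist (\<phi> k (\<theta> (- int k) \<omega>) ` D (\<theta> (- int k) \<omega>)) (attractor \<omega>)" for k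
  proof -
    obtain x where "x \<in> D (\<theta> (- int k) \<omega>)" using ne by blast
    then show ?thesis
      unfolding semidist_def by (intro SUP_upper2[of "\<phi> k (\<theta> (- int k) \<omega>) x"] INF_greatest) auto
  qed
  with \<open>a < 0\<close> show "\<forall>\<^sub>F k in sequentially.
      a < semidist (\<phi> k (\<theta> (- int k) \<omega>) ` D (\<theta> (- int k) \<omega>)) (attractor \<omega>)"
    by (intro always_eventually allI) (rule less_le_trans)
next
  fix a :: ereal assume "0 < a"
  then obtain e where e: "0 < ereal e" "ereal e < a"
    using ereal_dense2 by blast
  define U where "U = (\<Union>y\<in>attractor \<omega>. ball y e)"
  have "(\<Inter>n. pullback n \<omega>) \<subseteq> U"
    using e by (force simp: U_def attractor_def)
  then obtain m where m: "pullback m \<omega> \<subseteq> U"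
    using decseq_compact_subset_open[of "\<lambda>n. pullback n \<omega>" U] compact_pullback decseq_pullback \<omega>
    by (auto simp: U_def)
  let ?\<eta> = "\<theta> (- int m) \<omega>"
  have near: "semidist X (attractor \<omega>) < a" if X: "X \<subseteq> U" for X
  proof -
    have "semidist X (attractor \<omega>) \<le> ereal e"
      unfolding semidist_def
    proof (rule SUP_least)
      fix x assume "x \<in> X"
      then obtain y where "y \<in> attractor \<omega>" "x \<in> ball y e"
        using X unfolding U_def by blast
      then have "y \<in> attractor \<omega>" "dist x y \<le> e"
        by (auto simp: dist_commute)
      then show "(INF y\<in>attractor \<omega>. ereal (dist x y)) \<le> ereal e"
        by (intro INF_lower2[of y]) auto
    qed
    with e show ?thesis by simp
  qed
  have "\<forall>\<^sub>F k in sequentially. \<phi> k (\<theta> (- int k) ?\<eta>) ` D (\<theta> (- int k) ?\<eta>) \<subseteq> B ?\<eta>"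
    by (intro absorbed shift_closed \<omega>)
  then have "\<forall>\<^sub>F k in sequentially.
      semidist (\<phi> (k + m) (\<theta> (- int (k + m)) \<omega>) ` D (\<theta> (- int (k + m)) \<omega>)) (attractor \<omega>) < a"
  proof eventually_elim
    case (elim k)
    define \<xi> where "\<xi> = \<theta> (- int (k + m)) \<omega>"
    have xi: "\<theta> (- int k) ?\<eta> = \<xi>" and eta: "\<theta> (int k) \<xi> = ?\<eta>"
      by (simp_all add: shift_add \<xi>_def)
    have "\<phi> (k + m) \<xi> x = \<phi> m ?\<eta> (\<phi> k \<xi> x)" for x
      using cocycle_add[of m k \<xi> x] unfolding eta add.commute[of m k] .
    then have "\<phi> (k + m) \<xi> ` D \<xi> = \<phi> m ?\<eta> ` \<phi> k \<xi> ` D \<xi>"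
      by (simp add: image_image)
    also have "\<dots> \<subseteq> \<phi> m ?\<eta> ` B ?\<eta>"
      using elim by (intro image_mono) (simp add: xi)
    also have "\<dots> = pullback m \<omega>"
      by (simp add: pullback_def)
    finally have "\<phi> (k + m) \<xi> ` D \<xi> \<subseteq> U"
      using m by blast
    then show ?case
      unfolding \<xi>_def by (rule near)
  qed
  then show "\<forall>\<^sub>F k in sequentially.
      semidist (\<phi> k (\<theta> (- int k) \<omega>) ` D (\<theta> (- int k) \<omega>)) (attractor \<omega>) < a"
    by (rule eventually_sequentially_seg[THEN iffD1])
qed

end


section \<open>Lifting the circle to the real line\<close>

lemma rep_angle_of: "rep_angle (angle_of x) = x rmod (2 * pi)"
  unfolding angle_of_def by (rule Abs_angle_inverse) (simp add: rmod_nonneg rmod_less)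

lemma angle_of_rep: "angle_of (rep_angle a) = a"
  using rep_angle[of a] by (simp add: angle_of_def rep_angle_inverse)

lemma angle_of_eq_iff: "angle_of x = angle_of y \<longleftrightarrow> [x = y] (rmod (2 * pi))"
  by (metis angle_of_def rcong_def rep_angle_of)

lemma angle_lift_shift:
  obtains n :: int where "x = rep_angle (angle_of x) + of_int n * (2 * pi)"
proof -
  have "[x rmod (2 * pi) = x] (rmod (2 * pi))"
    by (simp add: rcong_def)
  then show ?thesis
    using that by (auto simp: rcong_altdef rep_angle_of)
qed

lemma angle_of_add_int: "angle_of (x + of_int n * (2 * pi)) = angle_of x"
  unfolding angle_of_eq_iff rcong_altdef by (rule exI[of _ "- n"]) simp

text \<open>Two lifts differ from their representatives by multiples of \<open>2 * pi\<close>. If the multiples differ,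
  then the lifts are at least \<open>2 * pi\<close> minus the distance of the representatives apart.\<close>

lemma dist_angle_of_le: "dist (angle_of x) (angle_of y) \<le> \<bar>x - y\<bar>"
proof -
  let ?r = "rep_angle (angle_of x)" and ?r' = "rep_angle (angle_of y)"
  obtain m n :: int where m: "x = ?r + of_int m * (2 * pi)" and n: "y = ?r' + of_int n * (2 * pi)"
    using angle_lift_shift by metis
  have b: "0 \<le> ?r" "?r < 2 * pi" "0 \<le> ?r'" "?r' < 2 * pi"
    using rep_angle[of "angle_of x"] rep_angle[of "angle_of y"] by auto
  have eq: "x - y = (?r - ?r') + of_int (m - n) * (2 * pi)"
    by (subst m, subst n) (simp add: algebra_simps)
  show ?thesis
  proof (cases "m = n")
    case True
    then show ?thesis using eq by (simp add: dist_angle_def)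
  next
    case False
    then have "1 \<le> \<bar>real_of_int (m - n)\<bar>"
      by linarith
    then have "1 * (2 * pi) \<le> \<bar>real_of_int (m - n)\<bar> * (2 * pi)"
      by (rule mult_right_mono) simp
    also have "\<dots> = \<bar>of_int (m - n) * (2 * pi)\<bar>"
      by (simp add: abs_mult)
    finally have "2 * pi - \<bar>?r - ?r'\<bar> \<le> \<bar>x - y\<bar>"
      unfolding eq by linarith
    then show ?thesis by (simp add: dist_angle_def)
  qed
qed

lemma angle_isometric_lift:
  obtains y where "angle_of y = v" "\<bar>x - y\<bar> = dist (angle_of x) v"
proof -
  let ?r = "rep_angle (angle_of x)" and ?r' = "rep_angle v"
  obtain m :: int where m: "x = ?r + of_int m * (2 * pi)"
    using angle_lift_shift by metis
  have lift: "angle_of (x + (?r' - ?r) + of_int n * (2 * pi)) = v" for n :: int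
  proof -
    have "x + (?r' - ?r) + of_int n * (2 * pi) = ?r' + of_int (m + n) * (2 * pi)"
      by (subst m) (simp add: algebra_simps)
    then show ?thesis
      by (simp only: angle_of_add_int angle_of_rep)
  qed
  have b: "0 \<le> ?r" "?r < 2 * pi" "0 \<le> ?r'" "?r' < 2 * pi"
    using rep_angle[of "angle_of x"] rep_angle[of v] by auto
  consider "\<bar>?r - ?r'\<bar> \<le> pi" | "?r - ?r' > pi" | "?r' - ?r > pi"
    by linarith
  then show thesis
  proof cases
    case 1
    with b show thesis
      using lift[of 0] by (intro that[of "x + (?r' - ?r)"]) (auto simp: dist_angle_def)
  next
    case 2
    with b show thesis
      using lift[of 1] by (intro that[of "x + (?r' - ?r) + 2 * pi"]) (auto simp: dist_angle_def)
  next
    case 3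
    with b show thesis
      using lift[of "-1"] by (intro that[of "x + (?r' - ?r) - 2 * pi"]) (auto simp: dist_angle_def)
  qed
qed

text \<open>States with the angle unrolled. Every map occurring in the scheme is the projection along \<open>cover\<close> of
  a map on a Euclidean space, where continuity, compactness and measurability are elementary.\<close>

type_synonym lifted = "real \<times> real \<times> real \<times> real"

definition cover :: "lifted \<Rightarrow> state" where
  "cover = (\<lambda>(v, p, u, q). (v, p, angle_of u, q))"

lemma cover_simp [simp]: "cover (v, p, u, q) = (v, p, angle_of u, q)"
  by (simp add: cover_def)

text \<open>Every state has a lift that is as close to a given lifted point as the states themselves are. This
  is what makes continuity descend along \<open>cover\<close>, although \<open>rep_angle\<close> is discontinuous.\<close>

lemma cover_isometric_lift:
  obtains z' where "cover z' = y" "dist z z' = dist (cover z) y"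
proof -
  obtain v p u q where z: "z = (v, p, u, q)" by (cases z)
  obtain v' p' a q' where y: "y = (v', p', a, q')" by (cases y)
  obtain u' where "angle_of u' = a" "\<bar>u - u'\<bar> = dist (angle_of u) a"
    using angle_isometric_lift by blast
  then show thesis
    using that[of "(v', p', u', q')"] by (simp add: z y dist_prod_def dist_real_def)
qed

lemma dist_cover_le: "dist (cover z) (cover z') \<le> dist z z'"
proof -
  have "(dist (angle_of u) (angle_of u'))\<^sup>2 \<le> (u - u')\<^sup>2" for u u'
    using power_mono[OF dist_angle_of_le zero_le_dist, of u u' 2] by simp
  then show ?thesis
    by (cases z; cases z') (auto simp: dist_prod_def dist_real_def)
qed

lemma continuous_on_cover [continuous_intros]:
  assumes "continuous_on A f"
  shows "continuous_on A (\<lambda>x. cover (f x))"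
proof -
  have "continuous_on UNIV cover"
    unfolding continuous_on_iff using dist_cover_le le_less_trans by blast
  then show ?thesis
    using assms by (rule continuous_on_compose2) simp
qed

lemma surj_cover: "surj cover"
  unfolding surj_def
proof
  fix y
  show "\<exists>z. y = cover z"
    by (rule cover_isometric_lift[of y]) auto
qed

lemma continuous_on_via_cover:
  fixes f :: "state \<Rightarrow> 'b::metric_space"
  assumes "continuous_on UNIV (\<lambda>z. f (cover z))"
  shows "continuous_on UNIV f"
  unfolding continuous_on_iff
proof (intro ballI allI impI)
  fix x and e :: real assume "0 < e"
  obtain z where z: "x = cover z"
    using surj_cover by blast
  obtain d where d: "d > 0" "\<And>z'. dist z' z < d \<Longrightarrow> dist (f (cover z')) (f (cover z)) < e"
    using assms \<open>0 < e\<close> unfolding continuous_on_iff by (metis UNIV_I)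
  have "dist (f y) (f x) < e" if "dist y x < d" for y
  proof -
    obtain z' where "cover z' = y" "dist z z' = dist (cover z) y"
      using cover_isometric_lift by blast
    with d(2)[of z'] that show ?thesis
      by (simp add: z dist_commute)
  qed
  with \<open>d > 0\<close> show "\<exists>d>0. \<forall>x'\<in>UNIV. dist x' x < d \<longrightarrow> dist (f x') (f x) < e"
    by blast
qed

lemma rep_angle_cover_simps:
  shows sin_rep_angle_of: "sin (rep_angle (angle_of u)) = sin u"
    and S_fun_rep_angle_of: "S_fun \<gamma> (rep_angle (angle_of u)) = S_fun \<gamma> u"
    and angle_of_rep_add: "angle_of (rep_angle (angle_of u) + x) = angle_of (u + x)"
proof -
  show "sin (rep_angle (angle_of u)) = sin u"
    by (simp add: rep_angle_of)
  then show "S_fun \<gamma> (rep_angle (angle_of u)) = S_fun \<gamma> u"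
    by (simp add: S_fun_def)
  have "[rep_angle (angle_of u) = u] (rmod (2 * pi))"
    by (simp add: rep_angle_of rcong_def)
  then show "angle_of (rep_angle (angle_of u) + x) = angle_of (u + x)"
    by (simp only: angle_of_eq_iff rcong_add_right_cancel)
qed


section \<open>One step of the scheme\<close>

locale scheme =
  fixes \<zeta>\<^sub>1 \<zeta>\<^sub>2 \<kappa>\<^sub>1 \<kappa>\<^sub>2 \<gamma> \<sigma> \<tau> :: real
  assumes \<zeta>\<^sub>1: "\<zeta>\<^sub>1 > 0" and \<zeta>\<^sub>2: "\<zeta>\<^sub>2 > 0" and \<kappa>\<^sub>1: "\<kappa>\<^sub>1 > 0" and \<gamma>: "0 < \<gamma>" "\<gamma> < 1" and \<tau>: "\<tau> > 0"
begin

lemma S_fun_sq: "(S_fun \<gamma> u)\<^sup>2 * (1 - \<gamma> * (sin u)\<^sup>2) = 1"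
  and S_fun_pos: "S_fun \<gamma> u > 0"
  and S_fun_ge_1: "1 \<le> S_fun \<gamma> u"
  and S_fun_le: "S_fun \<gamma> u \<le> 1 / (1 - \<gamma>)"
proof -
  have "\<gamma> * (sin u)\<^sup>2 \<le> \<gamma> * 1"
    using \<gamma> by (intro mult_left_mono) (auto simp: abs_square_le_1)
  then have m: "1 - \<gamma> \<le> 1 - \<gamma> * (sin u)\<^sup>2" by simp
  then have pos: "0 < 1 - \<gamma> * (sin u)\<^sup>2" using \<gamma> by linarith
  then show S_pos: "S_fun \<gamma> u > 0" by (simp add: S_fun_def)
  show sq: "(S_fun \<gamma> u)\<^sup>2 * (1 - \<gamma> * (sin u)\<^sup>2) = 1"
    using pos by (simp add: S_fun_def powr_power powr_minus field_simps)
  have "1 - \<gamma> * (sin u)\<^sup>2 \<le> 1" using \<gamma> by simp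
  then have "1 \<le> (S_fun \<gamma> u)\<^sup>2"
    using sq mult_left_mono[of "1 - \<gamma> * (sin u)\<^sup>2" 1 "(S_fun \<gamma> u)\<^sup>2"] by simp
  then show ge: "1 \<le> S_fun \<gamma> u"
    using S_pos by (metis abs_of_pos one_le_power power2_abs real_sqrt_abs real_sqrt_ge_one)
  have "S_fun \<gamma> u * (1 - \<gamma>) \<le> (S_fun \<gamma> u)\<^sup>2 * (1 - \<gamma> * (sin u)\<^sup>2)"
    using ge m \<gamma> S_pos by (intro mult_mono) (auto simp: power2_eq_square)
  then show "S_fun \<gamma> u \<le> 1 / (1 - \<gamma>)"
    using \<gamma> by (simp add: sq field_simps)
qed

lemma continuous_on_S_fun [continuous_intros]:
  fixes f :: "'c::t2_space \<Rightarrow> real"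
  assumes "continuous_on A f"
  shows "continuous_on A (\<lambda>x. S_fun \<gamma> (f x))"
proof -
  have "1 - \<gamma> * (sin u)\<^sup>2 \<noteq> 0" for u
    using S_fun_sq[of u] by auto
  then show ?thesis
    unfolding S_fun_def
    by (intro continuous_on_powr continuous_on_diff continuous_on_mult continuous_on_power
        continuous_on_sin continuous_on_const assms) (simp add: \<open>\<And>u. 1 - \<gamma> * (sin u)\<^sup>2 \<noteq> 0\<close>)
qed

text \<open>The linear system is solved by elimination. Its first equation says that \<open>V\<close> moves with the velocity
  \<open>w = P' + \<gamma> * S * sin u * Q'\<close>. Expressed through \<open>w\<close>, the other two read
  \<open>P' = new_P - damp * w\<close> and \<open>pivot * Q' = new_Q - S * sin u * damp * w\<close>; replacing
  \<open>P'\<close> by \<open>w - \<gamma> * S * sin u * Q'\<close> cancels the friction of \<open>Q'\<close> that is due to \<open>\<zeta>\<^sub>1\<close>.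
  Substituting both into the definition of \<open>w\<close> leaves one scalar equation, solved by \<open>velocity\<close>.\<close>

definition damp :: real where
  "damp = \<tau>\<^sup>2 * \<kappa>\<^sub>1 + 2 * \<tau> * \<zeta>\<^sub>1"

definition pivot :: "real \<Rightarrow> real" where
  "pivot u = 1 + 2 * \<tau> * (S_fun \<gamma> u)\<^sup>2 * \<zeta>\<^sub>2"

definition new_P :: "real \<Rightarrow> lifted \<Rightarrow> real" where
  "new_P d = (\<lambda>(V, P, u, Q). P - \<tau> * \<kappa>\<^sub>1 * V + \<sigma> * d)"

definition new_Q :: "real \<Rightarrow> lifted \<Rightarrow> real" where
  "new_Q d = (\<lambda>(V, P, u, Q). Q + S_fun \<gamma> u * sin u * (\<sigma> * d - \<tau> * \<kappa>\<^sub>2 - \<tau> * \<kappa>\<^sub>1 * V))"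

definition velocity :: "real \<Rightarrow> lifted \<Rightarrow> real" where
  "velocity d = (\<lambda>(V, P, u, Q).
     (new_P d (V, P, u, Q) + \<gamma> * (S_fun \<gamma> u * sin u) * new_Q d (V, P, u, Q) / pivot u) /
     (1 + damp + \<gamma> * (S_fun \<gamma> u * sin u)\<^sup>2 * damp / pivot u))"

definition lift_step :: "real \<Rightarrow> lifted \<Rightarrow> lifted" where
  "lift_step d = (\<lambda>(V, P, u, Q).
     let w = velocity d (V, P, u, Q);
         Q' = (new_Q d (V, P, u, Q) - S_fun \<gamma> u * sin u * damp * w) / pivot u
     in (V + \<tau> * w, new_P d (V, P, u, Q) - damp * w, u + \<tau> * S_fun \<gamma> u * Q', Q'))"

lemma damp_pos: "damp > 0"
  using \<tau> \<kappa>\<^sub>1 \<zeta>\<^sub>1 by (simp add: damp_def add_pos_pos)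

lemma pivot_pos: "pivot u > 0"
  using \<tau> \<zeta>\<^sub>2 by (simp add: pivot_def add_pos_nonneg)

lemma velocity_denominator_pos: "1 + damp + \<gamma> * (S_fun \<gamma> u * sin u)\<^sup>2 * damp / pivot u > 0"
  using damp_pos pivot_pos[of u] \<gamma> by (intro add_pos_nonneg) auto

text \<open>The system determines the new state uniquely, since the coefficient of \<open>w\<close> in the scalar equation is
  positive. Hence the definite description in the scheme denotes the projection of \<open>lift_step\<close>.\<close>

lemma scheme_eqs_cover_iff:
  "scheme_eqs \<zeta>\<^sub>1 \<zeta>\<^sub>2 \<kappa>\<^sub>1 \<kappa>\<^sub>2 \<gamma> \<sigma> \<tau> d (cover z) y \<longleftrightarrow> y = cover (lift_step d z)"
proof -
  obtain V P u Q where z: "z = (V, P, u, Q)" by (cases z)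
  obtain V' P' a Q' where y: "y = (V', P', a, Q')" by (cases y)
  define s S where "s = sin u" and "S = S_fun \<gamma> u"
  define w' where "w' = P' + \<gamma> * (S * s) * Q'"
  define w where "w = velocity d z"
  define D where "D = 1 + damp + \<gamma> * (S * s)\<^sup>2 * damp / pivot u"
  have b: "pivot u \<noteq> 0" and D: "D \<noteq> 0"
    using pivot_pos[of u] velocity_denominator_pos[of u] by (auto simp: D_def S_def s_def)
  have w: "w * D = new_P d z + \<gamma> * (S * s) * new_Q d z / pivot u"
    using D by (simp add: w_def velocity_def z D_def S_def s_def)
  have eqV: "V' = V + \<tau> * P' + \<tau> * \<gamma> * S * Q' * s \<longleftrightarrow> V' = V + \<tau> * w'"
    by (simp add: w'_def algebra_simps)
  have eqP: "P' = P - \<tau> * \<kappa>\<^sub>1 * V' - 2 * \<tau> * \<zeta>\<^sub>1 * P' - 2 * \<tau> * \<zeta>\<^sub>1 * \<gamma> * S * Q' * s + \<sigma> * d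
      \<longleftrightarrow> P' = new_P d z - damp * w'" if "V' = V + \<tau> * w'"
    unfolding that by (simp add: w'_def new_P_def z damp_def algebra_simps power2_eq_square)
  have eqQ: "Q' = Q - 2 * \<tau> * S\<^sup>2 * (\<zeta>\<^sub>2 + \<zeta>\<^sub>1 * \<gamma> * s\<^sup>2) * Q'
        - \<tau> * S * (\<kappa>\<^sub>2 + 2 * \<zeta>\<^sub>1 * P' + \<kappa>\<^sub>1 * V') * s + \<sigma> * S * s * d
      \<longleftrightarrow> pivot u * Q' = new_Q d z - S * s * damp * w'" if "V' = V + \<tau> * w'"
  proof -
    have "Q - 2 * \<tau> * S\<^sup>2 * (\<zeta>\<^sub>2 + \<zeta>\<^sub>1 * \<gamma> * s\<^sup>2) * Q'
        - \<tau> * S * (\<kappa>\<^sub>2 + 2 * \<zeta>\<^sub>1 * P' + \<kappa>\<^sub>1 * V') * s + \<sigma> * S * s * d - Q'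
      = new_Q d z - S * s * damp * w' - pivot u * Q'"
      unfolding that w'_def new_Q_def z damp_def pivot_def S_def[symmetric] s_def[symmetric]
        split by algebra
    then show ?thesis by linarith
  qed
  have "scheme_eqs \<zeta>\<^sub>1 \<zeta>\<^sub>2 \<kappa>\<^sub>1 \<kappa>\<^sub>2 \<gamma> \<sigma> \<tau> d (cover z) y \<longleftrightarrow>
      V' = V + \<tau> * w' \<and> P' = new_P d z - damp * w' \<and>
      pivot u * Q' = new_Q d z - S * s * damp * w' \<and> a = angle_of (u + \<tau> * S * Q')"
    (is "?lhs \<longleftrightarrow> ?rhs")
  proof -
    have "?lhs \<longleftrightarrow>
        V' = V + \<tau> * P' + \<tau> * \<gamma> * S * Q' * s \<and>
        P' = P - \<tau> * \<kappa>\<^sub>1 * V' - 2 * \<tau> * \<zeta>\<^sub>1 * P' - 2 * \<tau> * \<zeta>\<^sub>1 * \<gamma> * S * Q' * s + \<sigma> * d \<and>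
        a = angle_of (u + \<tau> * S * Q') \<and>
        Q' = Q - 2 * \<tau> * S\<^sup>2 * (\<zeta>\<^sub>2 + \<zeta>\<^sub>1 * \<gamma> * s\<^sup>2) * Q'
          - \<tau> * S * (\<kappa>\<^sub>2 + 2 * \<zeta>\<^sub>1 * P' + \<kappa>\<^sub>1 * V') * s + \<sigma> * S * s * d"
      unfolding scheme_eqs_def z y cover_simp split Let_def sin_rep_angle_of S_fun_rep_angle_of
        angle_of_rep_add S_def s_def ..
    also have "\<dots> \<longleftrightarrow> ?rhs"
      using eqV eqP eqQ by blast
    finally show ?thesis .
  qed
  also have "\<dots> \<longleftrightarrow> V' = V + \<tau> * w \<and> P' = new_P d z - damp * w \<and>
      pivot u * Q' = new_Q d z - S * s * damp * w \<and> a = angle_of (u + \<tau> * S * Q')"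
  proof -
    (* With x = w' these are the equations themselves, with x = w their explicit solution;
       both force w' to solve the scalar equation w' * D = w * D. *)
    have *: "w' = w" if "P' = new_P d z - damp * x" "pivot u * Q' = new_Q d z - S * s * damp * x"
      "x = w' \<or> x = w" for x
    proof -
      have Q': "Q' = (new_Q d z - S * s * damp * x) / pivot u"
        using that(2) b by (simp add: field_simps)
      have "w' = (new_P d z + \<gamma> * (S * s) * new_Q d z / pivot u)
          - (damp + \<gamma> * (S * s)\<^sup>2 * damp / pivot u) * x"
        unfolding w'_def that(1) Q'
        by (simp add: algebra_simps diff_divide_distrib power2_eq_square)
      also have "\<dots> = w * D - (D - 1) * x"
        by (simp only: w) (simp add: D_def)
      finally have "D * (w' - w) = 0 \<or> w' = w"
        using that(3) by (auto simp: algebra_simps)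
      with D show ?thesis by simp
    qed
    show ?thesis
    proof (cases "w' = w")
      case False
      then show ?thesis using *[of w'] *[of w] by blast
    qed simp
  qed
  also have "\<dots> \<longleftrightarrow> y = cover (lift_step d z)"
  proof -
    have "pivot u * Q' = new_Q d z - S * s * damp * w
        \<longleftrightarrow> Q' = (new_Q d z - S * s * damp * w) / pivot u"
      using b by (simp add: nonzero_eq_divide_eq mult.commute)
    then show ?thesis
      unfolding lift_step_def z y Let_def split S_def s_def w_def cover_simp prod.inject by blast
  qed
  finally show ?thesis .
qed

lemma scheme_step_cover:
  "scheme_step \<zeta>\<^sub>1 \<zeta>\<^sub>2 \<kappa>\<^sub>1 \<kappa>\<^sub>2 \<gamma> \<sigma> \<tau> d (cover z) = cover (lift_step d z)"
  by (simp only: scheme_step_def scheme_eqs_cover_iff the_eq_trivial)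

lemma continuous_on_lift_step: "continuous_on UNIV (\<lambda>(d, z). lift_step d z)"
proof -
  have nz: "1 + damp + \<gamma> * (S_fun \<gamma> u * sin u)\<^sup>2 * damp / pivot u \<noteq> 0" "pivot u \<noteq> 0" for u
    using pivot_pos[of u] velocity_denominator_pos[of u] by auto
  have S: "continuous_on UNIV (\<lambda>x :: real \<times> lifted. S_fun \<gamma> (fst (snd (snd (snd x)))))"
    by (intro continuous_on_S_fun continuous_intros)
  have piv: "continuous_on UNIV (\<lambda>x :: real \<times> lifted. pivot (fst (snd (snd (snd x)))))"
    unfolding pivot_def by (intro continuous_intros S)
  have P: "continuous_on UNIV (\<lambda>x :: real \<times> lifted. new_P (fst x) (snd x))"
    unfolding new_P_def split_beta by (intro continuous_intros)
  have Q: "continuous_on UNIV (\<lambda>x :: real \<times> lifted. new_Q (fst x) (snd x))"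
    unfolding new_Q_def split_beta by (intro continuous_intros S)
  have w: "continuous_on UNIV (\<lambda>x :: real \<times> lifted. velocity (fst x) (snd x))"
    using P Q unfolding velocity_def split_beta
    by (auto intro!: continuous_intros S piv simp: nz)
  show ?thesis
    using P Q w unfolding lift_step_def Let_def split_beta
    by (auto intro!: continuous_intros S piv simp: nz)
qed

end


section \<open>A Lyapunov function\<close>

lemma weighted_AM_GM:
  fixes x y a :: real
  assumes "a > 0"
  shows "2 * x * y \<le> a * x\<^sup>2 + y\<^sup>2 / a"
proof -
  have "0 \<le> (a * x - y)\<^sup>2 / a"
    using assms by simp
  also have "\<dots> = a * x\<^sup>2 + y\<^sup>2 / a - 2 * x * y"
    using assms by (simp add: power2_diff power2_eq_square field_simps)
  finally show ?thesis by simp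
qed

context scheme
begin

text \<open>The weight of the mixed term \<open>V * P\<close> in the Lyapunov function. The first two bounds make the
  function equivalent to \<open>V\<^sup>2 + P\<^sup>2 + Q\<^sup>2\<close> and keep the quadratic form of the increments nonnegative;
  the last two let the friction absorb what the mixed term produces in the velocities.\<close>

definition cross :: real where
  "cross = min (min 1 (sqrt \<kappa>\<^sub>1 / 2)) (min (2 * \<zeta>\<^sub>1 / (8 * \<zeta>\<^sub>1\<^sup>2 / \<kappa>\<^sub>1 + 3)) (2 * \<zeta>\<^sub>2))"

lemma cross_bounds:
  shows cross_pos: "0 < cross" and cross_le_1: "cross \<le> 1" and cross_sq: "cross\<^sup>2 \<le> \<kappa>\<^sub>1 / 4"
    and cross_le_\<zeta>\<^sub>1: "8 * \<zeta>\<^sub>1\<^sup>2 / \<kappa>\<^sub>1 * cross + 3 * cross \<le> 2 * \<zeta>\<^sub>1" and cross_le_\<zeta>\<^sub>2: "cross \<le> 2 * \<zeta>\<^sub>2"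
proof -
  have den: "0 < 8 * \<zeta>\<^sub>1\<^sup>2 / \<kappa>\<^sub>1 + 3"
    using \<kappa>\<^sub>1 by (intro add_nonneg_pos) auto
  then show pos: "0 < cross"
    using \<zeta>\<^sub>1 \<zeta>\<^sub>2 \<kappa>\<^sub>1 by (simp add: cross_def)
  show "cross \<le> 1" "cross \<le> 2 * \<zeta>\<^sub>2"
    by (simp_all add: cross_def)
  have "cross \<le> sqrt \<kappa>\<^sub>1 / 2"
    by (simp add: cross_def)
  then have "cross\<^sup>2 \<le> (sqrt \<kappa>\<^sub>1 / 2)\<^sup>2"
    using pos by (intro power_mono) auto
  then show "cross\<^sup>2 \<le> \<kappa>\<^sub>1 / 4"
    using \<kappa>\<^sub>1 by (simp add: power_divide)
  have "cross \<le> 2 * \<zeta>\<^sub>1 / (8 * \<zeta>\<^sub>1\<^sup>2 / \<kappa>\<^sub>1 + 3)"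
    unfolding cross_def by linarith
  then have "cross * (8 * \<zeta>\<^sub>1\<^sup>2 / \<kappa>\<^sub>1 + 3) \<le> 2 * \<zeta>\<^sub>1"
    using den by (simp only: pos_le_divide_eq)
  then show "8 * \<zeta>\<^sub>1\<^sup>2 / \<kappa>\<^sub>1 * cross + 3 * cross \<le> 2 * \<zeta>\<^sub>1"
    by (simp add: algebra_simps)
qed

text \<open>The variables \<open>P\<close> and \<open>Q\<close> diagonalise the kinetic energy: \<open>P\<^sup>2 + \<gamma> * Q\<^sup>2\<close> is twice that
  energy and \<open>\<kappa>\<^sub>1 * V\<^sup>2\<close> twice the potential energy of the spring. Friction acts on the velocities only;
  the mixed term transfers part of the dissipation to \<open>V\<close>.\<close>

definition energy :: "lifted \<Rightarrow> real" where
  "energy = (\<lambda>(V, P, u, Q). P\<^sup>2 + \<gamma> * Q\<^sup>2 + \<kappa>\<^sub>1 * V\<^sup>2 + 2 * cross * V * P)"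

lemma energy_upper: "energy (V, P, u, Q) \<le> 2 * P\<^sup>2 + \<gamma> * Q\<^sup>2 + (\<kappa>\<^sub>1 + 1) * V\<^sup>2"
proof -
  have "cross * (2 * V * P) \<le> cross * (1 * V\<^sup>2 + P\<^sup>2 / 1)"
    using cross_pos weighted_AM_GM[of 1 V P] by (intro mult_left_mono) auto
  also have "\<dots> \<le> 1 * (V\<^sup>2 + P\<^sup>2)"
    using mult_right_mono[OF cross_le_1, of "V\<^sup>2 + P\<^sup>2"] by simp
  finally show ?thesis by (simp add: energy_def algebra_simps)
qed

lemma energy_lower: "P\<^sup>2 / 2 + \<gamma> * Q\<^sup>2 + \<kappa>\<^sub>1 / 2 * V\<^sup>2 \<le> energy (V, P, u, Q)"
proof -
  have "2 * V * (- (cross * P)) \<le> \<kappa>\<^sub>1 / 2 * V\<^sup>2 + (- (cross * P))\<^sup>2 / (\<kappa>\<^sub>1 / 2)"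
    using \<kappa>\<^sub>1 by (intro weighted_AM_GM) simp
  also have "(- (cross * P))\<^sup>2 / (\<kappa>\<^sub>1 / 2) = (2 * cross\<^sup>2 / \<kappa>\<^sub>1) * P\<^sup>2"
    by (simp add: power_mult_distrib)
  also have "\<dots> \<le> 1 / 2 * P\<^sup>2"
    using cross_sq \<kappa>\<^sub>1 by (intro mult_right_mono) (auto simp: field_simps)
  finally show ?thesis by (simp add: energy_def algebra_simps)
qed

lemma energy_nonneg: "0 \<le> energy z"
proof -
  obtain V P u Q where z: "z = (V, P, u, Q)" by (cases z)
  have "0 \<le> P\<^sup>2 / 2 + \<gamma> * Q\<^sup>2 + \<kappa>\<^sub>1 / 2 * V\<^sup>2"
    using \<gamma> \<kappa>\<^sub>1 by simp
  with energy_lower[of P Q V u] show ?thesis by (simp add: z)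
qed

lemma energy_scaleR: "energy (r *\<^sub>R z) = r\<^sup>2 * energy z"
  by (cases z) (simp add: energy_def power_mult_distrib algebra_simps power2_eq_square)

lemma continuous_on_energy: "continuous_on UNIV energy"
  unfolding energy_def split_beta by (intro continuous_intros)

text \<open>The dissipation per unit time controls \<open>\<zeta>\<^sub>1 * w\<^sup>2 + \<zeta>\<^sub>2 * \<gamma> * r\<^sup>2 + cross * \<kappa>\<^sub>1 * V'\<^sup>2\<close>, while the new energy is
  at most \<open>4 * w\<^sup>2 + 5 * \<gamma> * r\<^sup>2 + (\<kappa>\<^sub>1 + 1) * V'\<^sup>2\<close>. The rate is the smallest quotient of the coefficients.\<close>

definition rate :: real where
  "rate = min (\<zeta>\<^sub>1 / 4) (min (\<zeta>\<^sub>2 / 5) (cross * \<kappa>\<^sub>1 / (\<kappa>\<^sub>1 + 1)))"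

lemma rate_pos: "rate > 0"
  using \<zeta>\<^sub>1 \<zeta>\<^sub>2 \<kappa>\<^sub>1 cross_pos by (simp add: rate_def)

definition decay :: real where
  "decay = 1 / (1 + rate * \<tau>)"

lemma decay_bounds: "0 < decay" "decay < 1"
  using rate_pos \<tau> by (simp_all add: decay_def add_pos_pos)

text \<open>What the bounded restoring torque \<open>\<kappa>\<^sub>2 * sin u\<close> and a noise increment \<open>d\<close> can add to the energy after the
  dissipation has absorbed their dependence on the state.\<close>

definition forcing :: "real \<Rightarrow> real" where
  "forcing d = \<tau> * \<gamma> * \<kappa>\<^sub>2\<^sup>2 / \<zeta>\<^sub>2 + (\<sigma>\<^sup>2 / (\<zeta>\<^sub>1 * \<tau>) + 2 * cross * \<sigma>\<^sup>2 / (\<kappa>\<^sub>1 * \<tau>)) * d\<^sup>2"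

lemma forcing_nonneg: "0 \<le> forcing d"
  using \<tau> \<gamma> \<zeta>\<^sub>1 \<zeta>\<^sub>2 \<kappa>\<^sub>1 cross_pos by (simp add: forcing_def)

text \<open>The implicit step obeys a discrete chain rule: \<open>x'\<^sup>2 - x\<^sup>2 = 2 * x' * (x' - x) - (x' - x)\<^sup>2\<close>. In the sum over
  the variables the coupling terms combine to \<open>w\<close>, the force of the spring cancels as in the continuous
  system, and the squares of the increments enter with the favourable sign. Here \<open>w\<close> and \<open>r\<close> are the
  velocities of \<open>V\<close> and of the angle.\<close>

lemma energy_balance:
  assumes step: "lift_step d (V, P, u, Q) = (V', P', u', Q')"
  defines "r \<equiv> S_fun \<gamma> u * Q'"
  defines "w \<equiv> P' + \<gamma> * sin u * r"
  shows "energy (V', P', u', Q') - energy (V, P, u, Q) =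
      - 4 * \<zeta>\<^sub>1 * \<tau> * w\<^sup>2 - 4 * \<gamma> * \<zeta>\<^sub>2 * \<tau> * r\<^sup>2 - 2 * \<gamma> * \<kappa>\<^sub>2 * \<tau> * sin u * r + 2 * \<sigma> * d * w
      + 2 * cross * (- \<tau> * \<kappa>\<^sub>1 * V'\<^sup>2 - 2 * \<zeta>\<^sub>1 * \<tau> * V' * w + \<sigma> * V' * d + \<tau> * w * P')
      - ((P' - P)\<^sup>2 + \<gamma> * (Q' - Q)\<^sup>2 + \<kappa>\<^sub>1 * (V' - V)\<^sup>2 + 2 * cross * (V' - V) * (P' - P))"
proof -
  define s S where "s = sin u" and "S = S_fun \<gamma> u"
  have "scheme_eqs \<zeta>\<^sub>1 \<zeta>\<^sub>2 \<kappa>\<^sub>1 \<kappa>\<^sub>2 \<gamma> \<sigma> \<tau> d (cover (V, P, u, Q)) (cover (V', P', u', Q'))"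
    by (simp only: scheme_eqs_cover_iff step)
  then have dV: "V' - V = \<tau> * P' + \<tau> * \<gamma> * S * Q' * s"
    and dP: "P' - P = - \<tau> * \<kappa>\<^sub>1 * V' - 2 * \<tau> * \<zeta>\<^sub>1 * P' - 2 * \<tau> * \<zeta>\<^sub>1 * \<gamma> * S * Q' * s + \<sigma> * d"
    and dQ: "Q' - Q = - 2 * \<tau> * S\<^sup>2 * (\<zeta>\<^sub>2 + \<zeta>\<^sub>1 * \<gamma> * s\<^sup>2) * Q'
               - \<tau> * S * (\<kappa>\<^sub>2 + 2 * \<zeta>\<^sub>1 * P' + \<kappa>\<^sub>1 * V') * s + \<sigma> * S * s * d"
    unfolding scheme_eqs_def cover_simp split Let_def sin_rep_angle_of S_fun_rep_angle_of
      S_def[symmetric] s_def[symmetric] by linarith+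
  have "energy (V', P', u', Q') - energy (V, P, u, Q) =
      2 * P' * (P' - P) + 2 * \<gamma> * Q' * (Q' - Q) + 2 * \<kappa>\<^sub>1 * V' * (V' - V)
      + 2 * cross * (V' * (P' - P) + P' * (V' - V))
      - ((P' - P)\<^sup>2 + \<gamma> * (Q' - Q)\<^sup>2 + \<kappa>\<^sub>1 * (V' - V)\<^sup>2 + 2 * cross * (V' - V) * (P' - P))"
    unfolding energy_def split by algebra
  moreover have "2 * P' * (P' - P) + 2 * \<gamma> * Q' * (Q' - Q) + 2 * \<kappa>\<^sub>1 * V' * (V' - V)
      + 2 * cross * (V' * (P' - P) + P' * (V' - V)) =
      - 4 * \<zeta>\<^sub>1 * \<tau> * w\<^sup>2 - 4 * \<gamma> * \<zeta>\<^sub>2 * \<tau> * r\<^sup>2 - 2 * \<gamma> * \<kappa>\<^sub>2 * \<tau> * s * r + 2 * \<sigma> * d * w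
      + 2 * cross * (- \<tau> * \<kappa>\<^sub>1 * V'\<^sup>2 - 2 * \<zeta>\<^sub>1 * \<tau> * V' * w + \<sigma> * V' * d + \<tau> * w * P')"
    unfolding dV dP dQ w_def r_def S_def[symmetric] s_def[symmetric] by algebra
  ultimately show ?thesis by (simp only: s_def)
qed

text \<open>Each indefinite term of the energy balance is split by the weighted arithmetic-geometric mean
  inequality: a fraction of the friction, or of the dissipation of \<open>V\<close> due to the mixed term, absorbs
  its quadratic part, and the rest is counted as forcing. Since the friction involves the new state, the
  estimate is a contraction after solving for the new energy.\<close>

lemma energy_lift_step_le: "energy (lift_step d z) \<le> decay * (energy z + forcing d)"
proof -
  obtain V P u Q where z: "z = (V, P, u, Q)" by (cases z)
  obtain V' P' u' Q' where z': "lift_step d z = (V', P', u', Q')" by (cases "lift_step d z")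
  define s S where "s = sin u" and "S = S_fun \<gamma> u"
  define r where "r = S * Q'"
  define w where "w = P' + \<gamma> * s * r"
  define E E' where "E = energy z" and "E' = energy (lift_step d z)"
  have s_sq: "s\<^sup>2 \<le> 1" by (simp add: s_def abs_square_le_1)
  have sr: "(s * r)\<^sup>2 \<le> r\<^sup>2"
    using s_sq by (simp add: power_mult_distrib mult_left_le_one_le)

  have balance: "E' - E =
      - 4 * \<zeta>\<^sub>1 * \<tau> * w\<^sup>2 - 4 * \<gamma> * \<zeta>\<^sub>2 * \<tau> * r\<^sup>2 + \<gamma> * \<tau> * (2 * r * (- \<kappa>\<^sub>2 * s)) + 2 * w * (\<sigma> * d)
      + cross * \<tau> * (- 2 * \<kappa>\<^sub>1 * V'\<^sup>2) + cross * \<tau> * (2 * V' * (- 2 * \<zeta>\<^sub>1 * w))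
      + cross * (2 * V' * (\<sigma> * d)) + cross * \<tau> * (2 * w * P')
      - ((P' - P)\<^sup>2 + \<gamma> * (Q' - Q)\<^sup>2 + \<kappa>\<^sub>1 * (V' - V)\<^sup>2 + 2 * cross * (V' - V) * (P' - P))"
    unfolding E_def E'_def z' unfolding z energy_balance[OF z'[unfolded z]] w_def r_def S_def s_def
    by algebra

  (* The squares of the increments form the energy of the increment. *)
  have dissipated: "0 \<le> (P' - P)\<^sup>2 + \<gamma> * (Q' - Q)\<^sup>2 + \<kappa>\<^sub>1 * (V' - V)\<^sup>2 + 2 * cross * (V' - V) * (P' - P)"
    using energy_nonneg[of "(V' - V, P' - P, u, Q' - Q)"] by (simp add: energy_def)

  have y1: "2 * r * (- \<kappa>\<^sub>2 * s) \<le> \<zeta>\<^sub>2 * r\<^sup>2 + \<kappa>\<^sub>2\<^sup>2 / \<zeta>\<^sub>2"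
  proof -
    have "2 * r * (- \<kappa>\<^sub>2 * s) \<le> \<zeta>\<^sub>2 * r\<^sup>2 + (- \<kappa>\<^sub>2 * s)\<^sup>2 / \<zeta>\<^sub>2"
      using \<zeta>\<^sub>2 by (rule weighted_AM_GM)
    also have "(- \<kappa>\<^sub>2 * s)\<^sup>2 \<le> \<kappa>\<^sub>2\<^sup>2"
      using s_sq by (simp add: power_mult_distrib mult_left_le)
    finally show ?thesis using \<zeta>\<^sub>2 by (simp add: divide_right_mono)
  qed
  have y2: "2 * w * (\<sigma> * d) \<le> \<zeta>\<^sub>1 * \<tau> * w\<^sup>2 + (\<sigma> * d)\<^sup>2 / (\<zeta>\<^sub>1 * \<tau>)"
    using \<zeta>\<^sub>1 \<tau> by (intro weighted_AM_GM) simp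
  have y3: "2 * V' * (- 2 * \<zeta>\<^sub>1 * w) \<le> \<kappa>\<^sub>1 / 2 * V'\<^sup>2 + 8 * \<zeta>\<^sub>1\<^sup>2 / \<kappa>\<^sub>1 * w\<^sup>2"
    using weighted_AM_GM[of "\<kappa>\<^sub>1 / 2" V' "- 2 * \<zeta>\<^sub>1 * w"] \<kappa>\<^sub>1 by (simp add: power_mult_distrib)
  have y4: "2 * V' * (\<sigma> * d) \<le> \<tau> * (\<kappa>\<^sub>1 / 2 * V'\<^sup>2) + 2 * (\<sigma> * d)\<^sup>2 / (\<kappa>\<^sub>1 * \<tau>)"
    using weighted_AM_GM[of "\<tau> * (\<kappa>\<^sub>1 / 2)" V' "\<sigma> * d"] \<kappa>\<^sub>1 \<tau> by (simp add: mult_ac)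
  have y5: "2 * w * P' \<le> 3 * w\<^sup>2 + \<gamma> * r\<^sup>2"
  proof -
    have "2 * w * (- (s * r)) \<le> 1 * w\<^sup>2 + (- (s * r))\<^sup>2 / 1"
      by (rule weighted_AM_GM) simp
    also have "\<dots> \<le> w\<^sup>2 + r\<^sup>2" using sr by simp
    finally have "\<gamma> * (2 * w * (- (s * r))) \<le> \<gamma> * (w\<^sup>2 + r\<^sup>2)"
      using \<gamma> by (intro mult_left_mono) auto
    moreover have "\<gamma> * w\<^sup>2 \<le> w\<^sup>2"
      using \<gamma> by (simp add: mult_left_le_one_le)
    ultimately show ?thesis
      by (simp add: w_def algebra_simps power2_eq_square)
  qed

  have m1: "\<gamma> * \<tau> * (2 * r * (- \<kappa>\<^sub>2 * s)) \<le> \<gamma> * \<tau> * (\<zeta>\<^sub>2 * r\<^sup>2 + \<kappa>\<^sub>2\<^sup>2 / \<zeta>\<^sub>2)"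
    using \<gamma> \<tau> by (intro mult_left_mono y1) simp
  have m3: "cross * \<tau> * (2 * V' * (- 2 * \<zeta>\<^sub>1 * w)) \<le> cross * \<tau> * (\<kappa>\<^sub>1 / 2 * V'\<^sup>2 + 8 * \<zeta>\<^sub>1\<^sup>2 / \<kappa>\<^sub>1 * w\<^sup>2)"
    using cross_pos \<tau> by (intro mult_left_mono y3) simp
  have m4: "cross * (2 * V' * (\<sigma> * d)) \<le> cross * (\<tau> * (\<kappa>\<^sub>1 / 2 * V'\<^sup>2) + 2 * (\<sigma> * d)\<^sup>2 / (\<kappa>\<^sub>1 * \<tau>))"
    using cross_pos by (intro mult_left_mono y4) simp
  have m5: "cross * \<tau> * (2 * w * P') \<le> cross * \<tau> * (3 * w\<^sup>2 + \<gamma> * r\<^sup>2)"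
    using cross_pos \<tau> by (intro mult_left_mono y5) simp
  have forcing: "forcing d = \<gamma> * \<tau> * (\<kappa>\<^sub>2\<^sup>2 / \<zeta>\<^sub>2) + (\<sigma> * d)\<^sup>2 / (\<zeta>\<^sub>1 * \<tau>) + cross * (2 * (\<sigma> * d)\<^sup>2 / (\<kappa>\<^sub>1 * \<tau>))"
    by (simp add: forcing_def power_mult_distrib algebra_simps)
  have c1: "\<tau> * w\<^sup>2 * (8 * \<zeta>\<^sub>1\<^sup>2 / \<kappa>\<^sub>1 * cross + 3 * cross) \<le> \<tau> * w\<^sup>2 * (2 * \<zeta>\<^sub>1)"
    using \<tau> by (intro mult_left_mono cross_le_\<zeta>\<^sub>1) simp
  have c2: "\<tau> * \<gamma> * r\<^sup>2 * cross \<le> \<tau> * \<gamma> * r\<^sup>2 * (2 * \<zeta>\<^sub>2)"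
    using \<tau> \<gamma> by (intro mult_left_mono cross_le_\<zeta>\<^sub>2) simp
  have "E' - E \<le> - 3 * \<zeta>\<^sub>1 * \<tau> * w\<^sup>2 - 3 * \<gamma> * \<zeta>\<^sub>2 * \<tau> * r\<^sup>2 - cross * \<tau> * \<kappa>\<^sub>1 * V'\<^sup>2
      + \<tau> * w\<^sup>2 * (8 * \<zeta>\<^sub>1\<^sup>2 / \<kappa>\<^sub>1 * cross + 3 * cross) + \<tau> * \<gamma> * r\<^sup>2 * cross + forcing d"
    using balance dissipated m1 y2 m3 m4 m5 unfolding forcing by (simp add: algebra_simps)
  also have "\<dots> \<le> - 3 * \<zeta>\<^sub>1 * \<tau> * w\<^sup>2 - 3 * \<gamma> * \<zeta>\<^sub>2 * \<tau> * r\<^sup>2 - cross * \<tau> * \<kappa>\<^sub>1 * V'\<^sup>2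
      + \<tau> * w\<^sup>2 * (2 * \<zeta>\<^sub>1) + \<tau> * \<gamma> * r\<^sup>2 * (2 * \<zeta>\<^sub>2) + forcing d"
    by (intro add_mono c1 c2 order_refl)
  also have "\<dots> = forcing d - \<tau> * (\<zeta>\<^sub>1 * w\<^sup>2 + \<zeta>\<^sub>2 * (\<gamma> * r\<^sup>2) + cross * \<kappa>\<^sub>1 * V'\<^sup>2)"
    by (simp add: algebra_simps)
  also have "\<dots> \<le> forcing d - \<tau> * (rate * E')"
  proof -
    have "P'\<^sup>2 \<le> 2 * w\<^sup>2 + 2 * (\<gamma> * r\<^sup>2)"
    proof -
      have "P'\<^sup>2 = (w - \<gamma> * (s * r))\<^sup>2"
        by (simp add: w_def)
      also have "\<dots> \<le> 2 * w\<^sup>2 + 2 * (\<gamma> * (s * r))\<^sup>2"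
        using zero_le_power2[of "w + \<gamma> * (s * r)"] unfolding power2_sum power2_diff by linarith
      also have "(\<gamma> * (s * r))\<^sup>2 \<le> \<gamma> * r\<^sup>2"
        using \<gamma> sr unfolding power_mult_distrib[of \<gamma>]
        by (intro mult_mono) (auto simp: power2_eq_square mult_left_le_one_le)
      finally show ?thesis by simp
    qed
    moreover have "Q'\<^sup>2 \<le> r\<^sup>2"
    proof -
      have "1 \<le> S\<^sup>2" using S_fun_ge_1[of u] by (simp add: S_def)
      then show ?thesis
        by (simp add: r_def power_mult_distrib mult_le_cancel_right1)
    qed
    then have "\<gamma> * Q'\<^sup>2 \<le> \<gamma> * r\<^sup>2"
      using \<gamma> by simp
    ultimately have "E' \<le> 4 * w\<^sup>2 + 5 * (\<gamma> * r\<^sup>2) + (\<kappa>\<^sub>1 + 1) * V'\<^sup>2"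
      using energy_upper[of V' P' u' Q'] unfolding E'_def z' by linarith
    then have "rate * E' \<le> rate * (4 * w\<^sup>2 + 5 * (\<gamma> * r\<^sup>2) + (\<kappa>\<^sub>1 + 1) * V'\<^sup>2)"
      using rate_pos by simp
    also have "\<dots> = rate * 4 * w\<^sup>2 + rate * 5 * (\<gamma> * r\<^sup>2) + rate * (\<kappa>\<^sub>1 + 1) * V'\<^sup>2"
      by (simp add: algebra_simps)
    also have "\<dots> \<le> \<zeta>\<^sub>1 * w\<^sup>2 + \<zeta>\<^sub>2 * (\<gamma> * r\<^sup>2) + cross * \<kappa>\<^sub>1 * V'\<^sup>2"
    proof -
      have "rate \<le> \<zeta>\<^sub>1 / 4" "rate \<le> \<zeta>\<^sub>2 / 5" and rate: "rate \<le> cross * \<kappa>\<^sub>1 / (\<kappa>\<^sub>1 + 1)"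
        unfolding rate_def min_le_iff_disj by simp_all
      then have "rate * 4 \<le> \<zeta>\<^sub>1" "rate * 5 \<le> \<zeta>\<^sub>2"
        by linarith+
      moreover from rate have "rate * (\<kappa>\<^sub>1 + 1) \<le> cross * \<kappa>\<^sub>1"
        using \<kappa>\<^sub>1 by (simp add: pos_le_divide_eq)
      ultimately show ?thesis
        using \<gamma> by (intro add_mono mult_right_mono) auto
    qed
    finally show ?thesis
      using \<tau> by simp
  qed
  finally have "E' * (1 + rate * \<tau>) \<le> E + forcing d"
    by (simp add: algebra_simps)
  moreover have "0 < 1 + rate * \<tau>"
    using rate_pos \<tau> by (simp add: add_pos_pos)
  ultimately show ?thesis
    by (simp add: decay_def E_def E'_def pos_le_divide_eq)
qed

end


section \<open>The cocycle\<close>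

context scheme
begin

primrec lift_flow :: "nat \<Rightarrow> path \<Rightarrow> lifted \<Rightarrow> lifted" where
  "lift_flow 0 \<omega> z = z"
| "lift_flow (Suc k) \<omega> z =
     lift_step (\<omega> (real (Suc k) * \<tau>) - \<omega> (real k * \<tau>)) (lift_flow k \<omega> z)"

lemma phi_bar_cover:
  "phi_bar \<zeta>\<^sub>1 \<zeta>\<^sub>2 \<kappa>\<^sub>1 \<kappa>\<^sub>2 \<gamma> \<sigma> \<tau> k \<omega> (cover z) = cover (lift_flow k \<omega> z)"
  by (induction k) (simp_all only: phi_bar.simps lift_flow.simps scheme_step_cover)

lemma continuous_on_lift_flow: "continuous_on UNIV (lift_flow k \<omega>)"
proof (induction k)
  case (Suc k)
  have "continuous_on UNIV (\<lambda>z. (case (c, lift_flow k \<omega> z) of (d, z) \<Rightarrow> lift_step d z))" for c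
    by (rule continuous_on_compose2[OF continuous_on_lift_step])
      (auto intro!: continuous_intros Suc.IH)
  then show ?case by (simp add: lift_flow.simps(2)[abs_def])
qed (simp add: lift_flow.simps(1)[abs_def])

lemma lift_flow_add:
  "lift_flow (k + j) \<omega> z = lift_flow k (shift (real j * \<tau>) \<omega>) (lift_flow j \<omega> z)"
proof (induction k)
  case (Suc k)
  have "\<omega> (real (Suc (k + j)) * \<tau>) - \<omega> (real (k + j) * \<tau>) =
      shift (real j * \<tau>) \<omega> (real (Suc k) * \<tau>) - shift (real j * \<tau>) \<omega> (real k * \<tau>)"
    by (simp add: shift_def algebra_simps)
  then show ?case
    by (simp only: add_Suc lift_flow.simps Suc.IH)
qed simp

definition J_lift :: "lifted \<Rightarrow> lifted" where
  "J_lift = (\<lambda>(V, P, u, Q). (V, P + \<gamma> * Q * sin u * S_fun \<gamma> u, u, Q * S_fun \<gamma> u))"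

definition J_unlift :: "lifted \<Rightarrow> lifted" where
  "J_unlift = (\<lambda>(x\<^sub>1, x\<^sub>2, u, x\<^sub>4). (x\<^sub>1, x\<^sub>2 - \<gamma> * x\<^sub>4 * sin u, u, x\<^sub>4 / S_fun \<gamma> u))"

lemma J_unlift_J_lift [simp]: "J_unlift (J_lift z) = z"
  using S_fun_pos by (cases z) (auto simp: J_lift_def J_unlift_def less_imp_neq[symmetric])

lemma J_lift_J_unlift [simp]: "J_lift (J_unlift z) = z"
  using S_fun_pos by (cases z) (auto simp: J_lift_def J_unlift_def less_imp_neq[symmetric])

lemma continuous_on_J_lift: "continuous_on UNIV J_lift"
  unfolding J_lift_def split_beta by (intro continuous_intros continuous_on_S_fun)

lemma continuous_on_J_unlift: "continuous_on UNIV J_unlift"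
proof -
  have "\<forall>x\<in>UNIV. S_fun \<gamma> (fst (snd (snd x))) \<noteq> 0" for x :: lifted
    using S_fun_pos by (auto simp: less_imp_neq[symmetric])
  then show ?thesis
    unfolding J_unlift_def split_beta by (intro continuous_intros continuous_on_S_fun) auto
qed

lemma J_map_cover: "J_map \<gamma> (cover z) = cover (J_lift z)"
  by (cases z) (simp add: J_map_def J_lift_def Let_def sin_rep_angle_of S_fun_rep_angle_of)

lemma inv_J_map_cover: "inv (J_map \<gamma>) (cover z) = cover (J_unlift z)"
proof (rule inv_f_eq)
  have "y = y'" if eq: "J_map \<gamma> y = J_map \<gamma> y'" for y y'
  proof -
    obtain V P a Q where y: "y = (V, P, a, Q)" by (cases y)
    obtain V' P' a' Q' where y': "y' = (V', P', a', Q')" by (cases y')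
    have a: "a' = a" using eq by (simp add: J_map_def Let_def y y')
    have "cover (J_lift (V, P, rep_angle a, Q)) = cover (J_lift (V', P', rep_angle a, Q'))"
      using eq by (simp add: J_map_cover[symmetric] y y' a angle_of_rep)
    then have "J_lift (V, P, rep_angle a, Q) = J_lift (V', P', rep_angle a, Q')"
      by (simp add: J_lift_def)
    then have "(V, P, rep_angle a, Q) = (V', P', rep_angle a, Q')"
      by (metis J_unlift_J_lift)
    then show ?thesis by (simp add: y y' a)
  qed
  then show "inj (J_map \<gamma>)" by (rule injI)
qed (simp add: J_map_cover)

definition flow :: "nat \<Rightarrow> path \<Rightarrow> state \<Rightarrow> state" where
  "flow = phi \<zeta>\<^sub>1 \<zeta>\<^sub>2 \<kappa>\<^sub>1 \<kappa>\<^sub>2 \<gamma> \<sigma> \<tau>"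

lemma flow_cover: "flow k \<omega> (cover z) = cover (J_lift (lift_flow k \<omega> (J_unlift z)))"
  by (simp add: flow_def phi_def inv_J_map_cover phi_bar_cover J_map_cover)

lemma flow_0: "flow 0 \<omega> x = x"
  using surj_cover flow_cover[of 0 \<omega>] by (metis J_lift_J_unlift lift_flow.simps(1) surjD)

lemma flow_add: "flow (k + j) \<omega> x = flow k (shift (real j * \<tau>) \<omega>) (flow j \<omega> x)"
proof -
  obtain z where "x = cover z" using surj_cover by blast
  then show ?thesis by (simp add: flow_cover lift_flow_add)
qed

text \<open>The maps act on the quotient, so continuity is read off from their lifts.\<close>

lemma continuous_on_flow: "continuous_on UNIV (flow k \<omega>)"
proof (rule continuous_on_via_cover)
  show "continuous_on UNIV (\<lambda>z. flow k \<omega> (cover z))"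
    unfolding flow_cover
    by (intro continuous_on_cover continuous_on_compose2[OF continuous_on_J_lift]
        continuous_on_compose2[OF continuous_on_lift_flow] continuous_on_J_unlift) auto
qed

text \<open>The sets that will absorb, in the coordinates of the transformed system.\<close>

definition sublevel :: "real \<Rightarrow> state set" where
  "sublevel \<rho> = (\<lambda>z. cover (J_lift z)) ` {z. energy z \<le> \<rho>}"

lemma sublevel_nonempty: "0 \<le> \<rho> \<Longrightarrow> sublevel \<rho> \<noteq> {}"
  by (auto simp: sublevel_def energy_def intro!: exI[of _ 0])

lemma flow_sublevel_eq: "flow k \<omega> ` sublevel \<rho> = (\<lambda>z. cover (J_lift (lift_flow k \<omega> z))) ` {z. energy z \<le> \<rho>}"
  by (simp add: sublevel_def image_image flow_cover)

lemma coordinate_bounds: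
  assumes "energy (V, P, u, Q) \<le> \<rho>"
  shows "V\<^sup>2 \<le> 2 / \<kappa>\<^sub>1 * \<rho>" "P\<^sup>2 \<le> 2 * \<rho>" "Q\<^sup>2 \<le> 1 / \<gamma> * \<rho>"
proof -
  have le: "P\<^sup>2 / 2 + \<gamma> * Q\<^sup>2 + \<kappa>\<^sub>1 / 2 * V\<^sup>2 \<le> \<rho>"
    using energy_lower assms by (rule order_trans)
  have nonneg: "0 \<le> P\<^sup>2" "0 \<le> \<gamma> * Q\<^sup>2" "0 \<le> \<kappa>\<^sub>1 / 2 * V\<^sup>2"
    using \<gamma> \<kappa>\<^sub>1 by auto
  have "\<kappa>\<^sub>1 / 2 * V\<^sup>2 \<le> \<rho>" "\<gamma> * Q\<^sup>2 \<le> \<rho>"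
    using le nonneg by linarith+
  then show "V\<^sup>2 \<le> 2 / \<kappa>\<^sub>1 * \<rho>" "Q\<^sup>2 \<le> 1 / \<gamma> * \<rho>"
    using \<kappa>\<^sub>1 \<gamma> by (simp_all add: field_simps)
  show "P\<^sup>2 \<le> 2 * \<rho>"
    using le nonneg by linarith
qed

text \<open>The lifted sublevel set is unbounded in the angle, but by periodicity the angles in \<open>[0, 2 * pi]\<close>
  already give the whole image.\<close>

lemma compact_sublevel: "compact (sublevel \<rho>)"
proof -
  define M where "M = max 0 \<rho>"
  define K where "K = {z. energy z \<le> \<rho>} \<inter>
    {- sqrt (2 / \<kappa>\<^sub>1 * M)..sqrt (2 / \<kappa>\<^sub>1 * M)} \<times> {- sqrt (2 * M)..sqrt (2 * M)} \<times> {0..2 * pi} \<times>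
    {- sqrt (1 / \<gamma> * M)..sqrt (1 / \<gamma> * M)}"
  have "closed {z. energy z \<le> \<rho>}"
    by (intro closed_Collect_le continuous_on_energy continuous_on_const)
  then have K: "compact K"
    unfolding K_def by (intro closed_Int_compact compact_Times compact_Icc)
  have "sublevel \<rho> = (\<lambda>z. cover (J_lift z)) ` K"
  proof
    show "sublevel \<rho> \<subseteq> (\<lambda>z. cover (J_lift z)) ` K"
    proof
      fix x assume "x \<in> sublevel \<rho>"
      then obtain V P u Q where x: "x = cover (J_lift (V, P, u, Q))" and E: "energy (V, P, u, Q) \<le> \<rho>"
        by (auto simp: sublevel_def)
      define u' where "u' = rep_angle (angle_of u)"
      have "energy (V, P, u, Q) \<le> M" using E by (simp add: M_def)
      note b = coordinate_bounds[OF this]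
      have "0 \<le> u'" "u' < 2 * pi"
        using rep_angle[of "angle_of u"] by (auto simp: u'_def)
      moreover have "energy (V, P, u', Q) \<le> \<rho>"
        using E by (simp add: energy_def)
      ultimately have "(V, P, u', Q) \<in> K"
        using b by (auto simp: K_def abs_le_iff[symmetric] real_le_rsqrt minus_le_iff)
      moreover have "x = cover (J_lift (V, P, u', Q))"
        by (simp add: x u'_def J_lift_def angle_of_rep sin_rep_angle_of S_fun_rep_angle_of)
      ultimately show "x \<in> (\<lambda>z. cover (J_lift z)) ` K" by blast
    qed
  qed (auto simp: sublevel_def K_def)
  also have "compact \<dots>"
    using K by (intro compact_continuous_image continuous_on_cover
      continuous_on_subset[OF continuous_on_J_lift]) auto
  finally show ?thesis .
qed

text \<open>A bound that is affine in the energy level suffices for temperedness; it comes from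
  \<open>\<bar>x\<bar> \<le> 1 + x\<^sup>2\<close> in every unbounded coordinate.\<close>

lemma sublevel_subset_ball:
  obtains C where "C > 0" "\<And>\<rho>. 0 \<le> \<rho> \<Longrightarrow> sublevel \<rho> \<subseteq> ball origin (C * (1 + \<rho>))"
proof -
  define m where "m = 1 / (1 - \<gamma>)"
  define C where "C = (2 / \<kappa>\<^sub>1 + 2 + 2 * m / \<gamma>) + (3 + pi + 2 * m)"
  have m: "m > 0" using \<gamma> by (simp add: m_def)
  have C: "C > 0" using m \<gamma> \<kappa>\<^sub>1 by (auto simp: C_def intro!: add_pos_pos)
  have abs_le: "\<bar>x\<bar> \<le> 1 + x\<^sup>2" for x :: real
    using weighted_AM_GM[of 1 "\<bar>x\<bar>" 1] zero_le_power2[of x] by simp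
  have "dist origin x < C * (1 + \<rho>)" if \<rho>: "0 \<le> \<rho>" and x_in: "x \<in> sublevel \<rho>" for \<rho> x
  proof -
    obtain V P u Q where x: "x = cover (J_lift (V, P, u, Q))" and E: "energy (V, P, u, Q) \<le> \<rho>"
      using x_in by (auto simp: sublevel_def)
    note b = coordinate_bounds[OF E]
    have QS: "\<bar>Q * S_fun \<gamma> u\<bar> \<le> (1 + Q\<^sup>2) * m"
      using abs_le[of Q] S_fun_pos[of u] S_fun_le[of u] unfolding m_def abs_mult
      by (intro mult_mono) auto
    have "\<bar>\<gamma> * sin u\<bar> * \<bar>Q * S_fun \<gamma> u\<bar> \<le> 1 * \<bar>Q * S_fun \<gamma> u\<bar>"
      using \<gamma> mult_mono[of \<gamma> 1 "\<bar>sin u\<bar>" 1] by (intro mult_right_mono) (auto simp: abs_mult)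
    then have sinQS: "\<bar>\<gamma> * Q * sin u * S_fun \<gamma> u\<bar> \<le> \<bar>Q * S_fun \<gamma> u\<bar>"
      by (simp add: abs_mult mult_ac)
    have ang: "dist (angle_of 0) (angle_of u) \<le> pi"
      unfolding dist_angle_def min_def by (auto simp: not_le)
    have sq: "sqrt (a\<^sup>2 + b\<^sup>2) \<le> a + c" if "0 \<le> a" "0 \<le> b" "b \<le> c" for a b c :: real
      using sqrt_sum_squares_le_sum[of a b] that by linarith
    have "dist origin x \<le> \<bar>V\<bar> + (\<bar>P + \<gamma> * Q * sin u * S_fun \<gamma> u\<bar> +
        (dist (angle_of 0) (angle_of u) + \<bar>Q * S_fun \<gamma> u\<bar>))"
      unfolding origin_def x J_lift_def split cover_simp dist_Pair_Pair dist_real_def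
      by (intro sq order_trans[OF sq]) auto
    also have "\<dots> \<le> (1 + V\<^sup>2) + ((1 + P\<^sup>2) + (1 + Q\<^sup>2) * m + (pi + (1 + Q\<^sup>2) * m))"
      using abs_le[of V] abs_le[of P] QS sinQS ang by linarith
    also have "\<dots> = (V\<^sup>2 + P\<^sup>2 + 2 * m * Q\<^sup>2) + (2 + pi + 2 * m)"
      by (simp add: algebra_simps)
    also have "\<dots> \<le> (2 / \<kappa>\<^sub>1 * \<rho> + 2 * \<rho> + 2 * m * (1 / \<gamma> * \<rho>)) + (2 + pi + 2 * m)"
      using b m by (intro add_mono mult_left_mono) auto
    also have "2 / \<kappa>\<^sub>1 * \<rho> + 2 * \<rho> + 2 * m * (1 / \<gamma> * \<rho>) = (2 / \<kappa>\<^sub>1 + 2 + 2 * m / \<gamma>) * \<rho>"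
      by (simp add: distrib_right)
    also have "\<dots> + (2 + pi + 2 * m) < C * (1 + \<rho>)"
    proof -
      have lin: "a * \<rho> + b < (a + (b + 1)) * (1 + \<rho>)" if "0 \<le> a" "0 \<le> (b + 1) * \<rho>" for a b :: real
        using that by (simp add: algebra_simps)
      have "0 \<le> 2 / \<kappa>\<^sub>1 + 2 + 2 * m / \<gamma>" "0 \<le> (2 + pi + 2 * m + 1) * \<rho>"
        using m \<gamma> \<kappa>\<^sub>1 \<rho> by auto
      from lin[OF this] show ?thesis by (simp add: C_def add_ac)
    qed
    finally show ?thesis .
  qed
  with C show thesis by (intro that[of C]) auto
qed

lemma energy_J_unlift_le:
  assumes "dist origin (cover z) \<le> r"
  shows "energy (J_unlift z) \<le> (10 + \<kappa>\<^sub>1) * r\<^sup>2"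
proof -
  obtain x\<^sub>1 x\<^sub>2 u x\<^sub>4 where z: "z = (x\<^sub>1, x\<^sub>2, u, x\<^sub>4)" by (cases z)
  have "\<bar>x\<^sub>1\<bar> \<le> dist origin (cover z)" "\<bar>x\<^sub>2\<bar> \<le> dist origin (cover z)" "\<bar>x\<^sub>4\<bar> \<le> dist origin (cover z)"
    using dist_fst_le[of origin "cover z"] dist_snd_le[of origin "cover z"]
      dist_fst_le[of "snd origin" "snd (cover z)"] dist_snd_le[of "snd origin" "snd (cover z)"]
      dist_snd_le[of "snd (snd origin)" "snd (snd (cover z))"]
    by (auto simp: z origin_def dist_real_def)
  then have b: "\<bar>x\<^sub>1\<bar> \<le> r" "\<bar>x\<^sub>2\<bar> \<le> r" "\<bar>x\<^sub>4\<bar> \<le> r"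
    using assms by linarith+
  have gs: "\<bar>\<gamma> * sin u\<bar> \<le> 1"
    using \<gamma> mult_mono[of \<gamma> 1 "\<bar>sin u\<bar>" 1] by (auto simp: abs_mult)
  have "\<bar>\<gamma> * sin u\<bar> * \<bar>x\<^sub>4\<bar> \<le> 1 * r"
    using gs b by (intro mult_mono) auto
  moreover have "\<bar>\<gamma> * x\<^sub>4 * sin u\<bar> = \<bar>\<gamma> * sin u\<bar> * \<bar>x\<^sub>4\<bar>"
    by (simp add: abs_mult)
  ultimately have "\<bar>x\<^sub>2 - \<gamma> * x\<^sub>4 * sin u\<bar> \<le> \<bar>2 * r\<bar>"
    using b(2) by linarith
  then have P: "(x\<^sub>2 - \<gamma> * x\<^sub>4 * sin u)\<^sup>2 \<le> (2 * r)\<^sup>2"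
    by (rule abs_le_square_iff[THEN iffD1])
  have "\<bar>x\<^sub>4 / S_fun \<gamma> u\<bar> \<le> \<bar>x\<^sub>4\<bar> / 1"
    unfolding abs_divide using S_fun_ge_1[of u] by (intro divide_left_mono) auto
  then have "(x\<^sub>4 / S_fun \<gamma> u)\<^sup>2 \<le> r\<^sup>2"
    using b by (intro abs_le_square_iff[THEN iffD1]) simp
  then have "\<gamma> * (x\<^sub>4 / S_fun \<gamma> u)\<^sup>2 \<le> 1 * r\<^sup>2"
    using \<gamma> by (intro mult_mono) auto
  moreover have "(\<kappa>\<^sub>1 + 1) * x\<^sub>1\<^sup>2 \<le> (\<kappa>\<^sub>1 + 1) * r\<^sup>2"
    using \<kappa>\<^sub>1 b by (intro mult_left_mono abs_le_square_iff[THEN iffD1]) auto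
  ultimately show ?thesis
    using energy_upper[of x\<^sub>1 "x\<^sub>2 - \<gamma> * x\<^sub>4 * sin u" u "x\<^sub>4 / S_fun \<gamma> u"] P
    by (simp add: z J_unlift_def algebra_simps power_mult_distrib)
qed

end


section \<open>Paths of sublinear growth\<close>

lemma shift_shift: "shift s (shift t \<omega>) = shift (s + t) \<omega>"
  by (auto simp: shift_def algebra_simps)

lemma shift_zero: "\<omega> 0 = 0 \<Longrightarrow> shift 0 \<omega> = \<omega>"
  by (simp add: shift_def)

lemma sublinear_imp_linear_bound:
  fixes \<omega> :: path
  assumes cont: "continuous_on UNIV \<omega>" and lim: "((\<lambda>t. \<omega> t / t) \<longlongrightarrow> 0) at_bot"
  obtains a where "a > 0" "\<And>s. s \<le> 0 \<Longrightarrow> \<bar>\<omega> s\<bar> \<le> a * (1 - s)"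
proof -
  have "\<forall>\<^sub>F t in at_bot. \<bar>\<omega> t / t\<bar> < 1"
    using lim by (auto simp: tendsto_iff dist_real_def)
  then obtain N where N: "\<And>t. t \<le> N \<Longrightarrow> \<bar>\<omega> t / t\<bar> < 1"
    unfolding eventually_at_bot_linorder by blast
  have "bounded (\<omega> ` {min N (-1)..0})"
    by (intro compact_imp_bounded compact_continuous_image continuous_on_subset[OF cont]) auto
  then obtain b where b: "\<bar>\<omega> s\<bar> \<le> b" if "s \<in> {min N (-1)..0}" for s
    unfolding bounded_iff by (metis imageI real_norm_def)
  have "\<bar>\<omega> s\<bar> \<le> max 1 b * (1 - s)" if "s \<le> 0" for s
  proof (cases "min N (-1) \<le> s")
    case True
    then have "\<bar>\<omega> s\<bar> \<le> max 1 b * 1"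
      using b[of s] that by auto
    also have "\<dots> \<le> max 1 b * (1 - s)"
      using that by (intro mult_left_mono) auto
    finally show ?thesis .
  next
    case False
    then have "s \<le> N" "s < 0" by auto
    then have "\<bar>\<omega> s\<bar> < - s"
      using N[of s] by (simp add: abs_divide field_simps)
    also have "- s \<le> 1 * (1 - s)" by simp
    also have "\<dots> \<le> max 1 b * (1 - s)"
      using \<open>s < 0\<close> by (intro mult_right_mono) auto
    finally show ?thesis by simp
  qed
  then show thesis by (intro that[of "max 1 b"]) auto
qed

text \<open>Ratio test: the quotient of successive terms tends to \<open>q\<close>, and \<open>(1 + q) / 2\<close> lies between \<open>q\<close> and \<open>1\<close>.\<close>

lemma summable_square_geometric:
  fixes q c :: real
  assumes q: "0 < q" "q < 1" and c: "0 < c"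
  shows "summable (\<lambda>n. q ^ n * (1 + real n * c)\<^sup>2)"
proof -
  have "(\<lambda>n. q * ((1 + (real n + 1) * c) / (1 + real n * c))\<^sup>2) \<longlonglongrightarrow> q * 1\<^sup>2"
    by (intro tendsto_intros) (use c in real_asymp)
  moreover have "q * 1\<^sup>2 < (1 + q) / 2"
    using q by simp
  ultimately have "\<forall>\<^sub>F n in sequentially. q * ((1 + (real n + 1) * c) / (1 + real n * c))\<^sup>2 < (1 + q) / 2"
    by (rule order_tendstoD)
  then obtain N where N: "\<And>n. n \<ge> N \<Longrightarrow> q * ((1 + (real n + 1) * c) / (1 + real n * c))\<^sup>2 < (1 + q) / 2"
    unfolding eventually_sequentially by blast
  show ?thesis
  proof (rule summable_ratio_test[of "(1 + q) / 2" N])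
    fix n assume "n \<ge> N"
    have pos: "0 < 1 + real n * c" using c by (simp add: add_pos_nonneg)
    have "q ^ Suc n * (1 + real (Suc n) * c)\<^sup>2 =
        (q * ((1 + (real n + 1) * c) / (1 + real n * c))\<^sup>2) * (q ^ n * (1 + real n * c)\<^sup>2)"
      using pos by (simp add: power_divide field_simps)
    also have "\<dots> \<le> (1 + q) / 2 * (q ^ n * (1 + real n * c)\<^sup>2)"
      using N[OF \<open>n \<ge> N\<close>] q by (intro mult_right_mono) auto
    finally show "norm (q ^ Suc n * (1 + real (Suc n) * c)\<^sup>2) \<le> (1 + q) / 2 * norm (q ^ n * (1 + real n * c)\<^sup>2)"
      using q by simp
  qed (use q in simp)
qed

text \<open>On the logarithmic scale \<open>q ^ k\<close> decreases with slope \<open>\<delta> = - ln q\<close> in \<open>k\<close>, while \<open>ln (max 1 (r k))\<close> is eventually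
  below \<open>k * \<delta> / 4\<close>, so that its double and the constant \<open>ln C\<close> can each be charged to half of the slope.\<close>

lemma geometric_beats_subexponential:
  fixes q c C :: real and r :: "nat \<Rightarrow> real"
  assumes q: "0 < q" "q < 1" and c: "0 < c" and C: "0 < C"
    and lim: "(\<lambda>k. 1 / (real k * c) * ln (max 1 (r k))) \<longlonglongrightarrow> 0"
  shows "\<forall>\<^sub>F k in sequentially. q ^ k * (C * (max 1 (r k))\<^sup>2) \<le> 1"
proof -
  define \<delta> where "\<delta> = - ln q"
  have \<delta>: "\<delta> > 0" using q by (simp add: \<delta>_def)
  have "\<forall>\<^sub>F k in sequentially. 1 / (real k * c) * ln (max 1 (r k)) < \<delta> / (4 * c)"
    using lim \<delta> c by (intro order_tendstoD(2)[OF lim]) simp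
  moreover have "\<forall>\<^sub>F k in sequentially. ln C \<le> real k * (\<delta> / 2)"
    using \<delta> by real_asymp
  moreover have "\<forall>\<^sub>F k :: nat in sequentially. k > 0"
    by (rule eventually_gt_at_top)
  ultimately show ?thesis
  proof eventually_elim
    case (elim k)
    define m where "m = max 1 (r k)"
    have m: "m > 0" by (simp add: m_def)
    have "ln m < \<delta> / (4 * c) * (real k * c)"
      using elim(1,3) c by (simp add: m_def pos_divide_less_eq)
    also have "\<dots> = real k * (\<delta> / 4)"
      using c by simp
    finally have "- (real k * \<delta>) + (ln C + 2 * ln m) \<le> 0"
      using elim(2) by simp
    moreover have "ln (q ^ k * (C * m\<^sup>2)) = - (real k * \<delta>) + (ln C + 2 * ln m)"
      using q C m by (simp add: ln_mult ln_realpow \<delta>_def)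
    ultimately show ?case
      unfolding m_def[symmetric] using q C m by (subst ln_le_zero_iff[symmetric]) auto
  qed
qed


section \<open>The absorbing radius\<close>

text \<open>The properties of the restricted path space on which the attractor rests: invariance under all
  shifts, sublinear growth towards the past, and increments that are random variables.\<close>

locale driven_scheme = scheme +
  fixes M :: "path measure"
  assumes space_C0: "\<omega> \<in> space M \<Longrightarrow> \<omega> \<in> C0"
    and space_shift: "\<omega> \<in> space M \<Longrightarrow> shift t \<omega> \<in> space M"
    and space_sublinear: "\<omega> \<in> space M \<Longrightarrow> ((\<lambda>t. \<omega> t / t) \<longlongrightarrow> 0) at_bot"
    and measurable_increment [measurable]: "(\<lambda>\<omega>. \<omega> t - \<omega> s) \<in> borel_measurable M"
begin

text \<open>The forcing of the past, discounted by the contraction of the energy. Its sum is the stationary solution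
  of the recursion \<open>\<rho>' = decay * (\<rho> + forcing d)\<close> that dominates the energy, which is the content of
  \<open>radius_shift\<close>.\<close>

definition past_forcing :: "path \<Rightarrow> nat \<Rightarrow> real" where
  "past_forcing \<omega> j = decay ^ Suc j * forcing (\<omega> (- (real j * \<tau>)) - \<omega> (- (real (Suc j) * \<tau>)))"

definition radius :: "path \<Rightarrow> real" where
  "radius \<omega> = suminf (past_forcing \<omega>)"

lemma past_forcing_nonneg: "0 \<le> past_forcing \<omega> j"
  using decay_bounds forcing_nonneg by (simp add: past_forcing_def)

text \<open>The path is bounded by an affine function of the past time, so the increment over the \<open>j\<close>-th past step
  seen from time \<open>-t\<close> is at most a multiple of \<open>(1 + t) * (1 + (j + 1) * \<tau>)\<close>, and the forcing is quadratic
  in the increment. The product form separates \<open>t\<close> from the summation index.\<close>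

lemma past_forcing_bound:
  assumes "\<omega> \<in> space M"
  obtains A where "A \<ge> 0"
    "\<And>t j. 0 \<le> t \<Longrightarrow>
      past_forcing (shift (- t) \<omega>) j \<le> A * (1 + t)\<^sup>2 * (decay ^ Suc j * (1 + real (Suc j) * \<tau>)\<^sup>2)"
proof -
  have "continuous_on UNIV \<omega>" using space_C0[OF assms] by (simp add: C0_def)
  then obtain a where a: "a > 0" "\<And>s. s \<le> 0 \<Longrightarrow> \<bar>\<omega> s\<bar> \<le> a * (1 - s)"
    using sublinear_imp_linear_bound space_sublinear[OF assms] by blast
  (* The coefficients of the quadratic polynomial forcing. *)
  define c\<^sub>0 c\<^sub>1 where "c\<^sub>0 = forcing 0" and "c\<^sub>1 = forcing 1 - forcing 0"
  have forcing: "forcing d = c\<^sub>0 + c\<^sub>1 * d\<^sup>2" for d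
    by (simp add: forcing_def c\<^sub>0_def c\<^sub>1_def)
  have c: "0 \<le> c\<^sub>0" "0 \<le> c\<^sub>1"
    using forcing_nonneg[of 0] \<tau> \<gamma> \<zeta>\<^sub>1 \<zeta>\<^sub>2 \<kappa>\<^sub>1 cross_pos by (simp_all add: c\<^sub>0_def c\<^sub>1_def forcing_def)
  have "past_forcing (shift (- t) \<omega>) j \<le>
      (c\<^sub>0 + c\<^sub>1 * (2 * a)\<^sup>2) * (1 + t)\<^sup>2 * (decay ^ Suc j * (1 + real (Suc j) * \<tau>)\<^sup>2)" if t: "0 \<le> t" for t j
  proof -
    define g where "g = (1 + t) * (1 + real (Suc j) * \<tau>)"
    define d where "d = shift (- t) \<omega> (- (real j * \<tau>)) - shift (- t) \<omega> (- (real (Suc j) * \<tau>))"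
    have d: "d = \<omega> (- t + - (real j * \<tau>)) - \<omega> (- t + - (real (Suc j) * \<tau>))"
      unfolding d_def shift_def by simp
    have n: "0 \<le> real j * \<tau>" "0 \<le> real (Suc j) * \<tau>" "real j * \<tau> \<le> real (Suc j) * \<tau>" "0 \<le> t * (real (Suc j) * \<tau>)"
      using \<tau> t by auto
    have "g = 1 + t + real (Suc j) * \<tau> + t * (real (Suc j) * \<tau>)"
      unfolding g_def by (simp add: algebra_simps)
    with n t have g: "1 + t + real (Suc j) * \<tau> \<le> g" "1 \<le> g"
      by linarith+
    have "\<bar>\<omega> (- t + - (real j * \<tau>))\<bar> \<le> a * (1 - (- t + - (real j * \<tau>)))"
      using n t by (intro a) linarith
    also have "\<dots> \<le> a * g"
      using g n a(1) by (intro mult_left_mono) linarith+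
    finally have 1: "\<bar>\<omega> (- t + - (real j * \<tau>))\<bar> \<le> a * g" .
    have "\<bar>\<omega> (- t + - (real (Suc j) * \<tau>))\<bar> \<le> a * (1 - (- t + - (real (Suc j) * \<tau>)))"
      using n t by (intro a) linarith
    also have "\<dots> \<le> a * g"
      using g n a(1) by (intro mult_left_mono) linarith+
    finally have "\<bar>d\<bar> \<le> \<bar>2 * a * g\<bar>"
      using 1 by (simp add: d)
    then have "d\<^sup>2 \<le> (2 * a * g)\<^sup>2"
      by (rule abs_le_square_iff[THEN iffD1])
    then have "c\<^sub>1 * d\<^sup>2 \<le> c\<^sub>1 * (2 * a * g)\<^sup>2"
      using c by (intro mult_left_mono)
    moreover have "c\<^sub>0 * 1 \<le> c\<^sub>0 * g\<^sup>2"
      using c g by (intro mult_left_mono one_le_power)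
    ultimately have "forcing d \<le> (c\<^sub>0 + c\<^sub>1 * (2 * a)\<^sup>2) * g\<^sup>2"
      by (simp add: forcing power_mult_distrib distrib_right mult.assoc)
    then have "decay ^ Suc j * forcing d \<le> decay ^ Suc j * ((c\<^sub>0 + c\<^sub>1 * (2 * a)\<^sup>2) * g\<^sup>2)"
      using decay_bounds by (intro mult_left_mono) auto
    also have "\<dots> = (c\<^sub>0 + c\<^sub>1 * (2 * a)\<^sup>2) * (1 + t)\<^sup>2 * (decay ^ Suc j * (1 + real (Suc j) * \<tau>)\<^sup>2)"
      unfolding g_def power_mult_distrib by (simp only: mult_ac)
    finally show ?thesis
      by (simp only: past_forcing_def d_def)
  qed
  with c show thesis by (intro that[of "c\<^sub>0 + c\<^sub>1 * (2 * a)\<^sup>2"]) auto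
qed

lemma summable_weight: "summable (\<lambda>j. decay ^ Suc j * (1 + real (Suc j) * \<tau>)\<^sup>2)"
  using summable_square_geometric[OF decay_bounds \<tau>] by (subst summable_Suc_iff)

lemma summable_past_forcing:
  assumes "\<omega> \<in> space M"
  shows "summable (past_forcing \<omega>)"
proof -
  obtain A where A: "\<And>t j. 0 \<le> t \<Longrightarrow>
      past_forcing (shift (- t) \<omega>) j \<le> A * (1 + t)\<^sup>2 * (decay ^ Suc j * (1 + real (Suc j) * \<tau>)\<^sup>2)"
    using past_forcing_bound[OF assms] by blast
  have "shift (- 0) \<omega> = \<omega>"
    using space_C0[OF assms] by (simp add: shift_zero C0_def)
  then have "norm (past_forcing \<omega> j) \<le> A * (decay ^ Suc j * (1 + real (Suc j) * \<tau>)\<^sup>2)" for j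
    using A[of 0 j] past_forcing_nonneg[of \<omega> j] by simp
  then show ?thesis
    by (intro summable_comparison_test'[OF summable_mult[OF summable_weight]])
qed

lemma radius_nonneg: "\<omega> \<in> space M \<Longrightarrow> 0 \<le> radius \<omega>"
  unfolding radius_def by (intro suminf_nonneg summable_past_forcing past_forcing_nonneg)

lemma radius_growth:
  assumes "\<omega> \<in> space M"
  obtains K where "K \<ge> 0" "\<And>t. 0 \<le> t \<Longrightarrow> radius (shift (- t) \<omega>) \<le> K * (1 + t)\<^sup>2"
proof -
  obtain A where A: "A \<ge> 0" "\<And>t j. 0 \<le> t \<Longrightarrow>
      past_forcing (shift (- t) \<omega>) j \<le> A * (1 + t)\<^sup>2 * (decay ^ Suc j * (1 + real (Suc j) * \<tau>)\<^sup>2)"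
    using past_forcing_bound[OF assms] by blast
  define s where "s = (\<Sum>j. decay ^ Suc j * (1 + real (Suc j) * \<tau>)\<^sup>2)"
  have s: "0 \<le> s"
    unfolding s_def using decay_bounds by (intro suminf_nonneg summable_weight) auto
  have "radius (shift (- t) \<omega>) \<le> A * s * (1 + t)\<^sup>2" if "0 \<le> t" for t
  proof -
    have "radius (shift (- t) \<omega>) \<le> (\<Sum>j. A * (1 + t)\<^sup>2 * (decay ^ Suc j * (1 + real (Suc j) * \<tau>)\<^sup>2))"
      unfolding radius_def using A(2)[OF that]
      by (intro suminf_le summable_past_forcing space_shift assms summable_mult[OF summable_weight])
    also have "\<dots> = A * (1 + t)\<^sup>2 * s"
      unfolding s_def by (rule suminf_mult[OF summable_weight])
    finally show ?thesis by (simp add: mult_ac)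
  qed
  with A s show thesis by (intro that[of "A * s"]) auto
qed

lemma radius_shift:
  assumes "\<omega> \<in> space M"
  shows "radius (shift \<tau> \<omega>) = decay * (radius \<omega> + forcing (\<omega> \<tau> - \<omega> 0))"
proof -
  have "past_forcing (shift \<tau> \<omega>) 0 = decay * forcing (\<omega> \<tau> - \<omega> 0)"
    by (simp add: past_forcing_def shift_def)
  moreover have "past_forcing (shift \<tau> \<omega>) (Suc j) = decay * past_forcing \<omega> j" for j
    by (simp add: past_forcing_def shift_def algebra_simps)
  then have "(\<Sum>j. past_forcing (shift \<tau> \<omega>) (Suc j)) = decay * radius \<omega>"
    by (simp add: radius_def suminf_mult summable_past_forcing assms)
  ultimately show ?thesis
    using suminf_split_head[OF summable_past_forcing[OF space_shift[OF assms, of \<tau>]]]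
    by (simp add: radius_def algebra_simps)
qed

text \<open>The excess of the energy over the stationary radius contracts geometrically.\<close>

lemma energy_lift_flow_le:
  assumes "\<omega> \<in> space M" "energy z \<le> radius \<omega> + a"
  shows "energy (lift_flow k \<omega> z) \<le> radius (shift (real k * \<tau>) \<omega>) + decay ^ k * a"
proof (induction k)
  case 0
  have "shift 0 \<omega> = \<omega>"
    using space_C0[OF assms(1)] by (simp add: shift_zero C0_def)
  with assms(2) show ?case by simp
next
  case (Suc k)
  let ?\<eta> = "shift (real k * \<tau>) \<omega>"
  have inc: "\<omega> (real (Suc k) * \<tau>) - \<omega> (real k * \<tau>) = ?\<eta> \<tau> - ?\<eta> 0"
    by (simp add: shift_def algebra_simps)
  have "energy (lift_flow (Suc k) \<omega> z) \<le> decay * (energy (lift_flow k \<omega> z) + forcing (?\<eta> \<tau> - ?\<eta> 0))"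
    unfolding lift_flow.simps inc by (rule energy_lift_step_le)
  also have "\<dots> \<le> decay * ((radius ?\<eta> + decay ^ k * a) + forcing (?\<eta> \<tau> - ?\<eta> 0))"
    using decay_bounds Suc.IH by (intro mult_left_mono add_right_mono) auto
  also have "\<dots> = radius (shift \<tau> ?\<eta>) + decay ^ Suc k * a"
    by (simp add: radius_shift space_shift assms(1) algebra_simps)
  also have "shift \<tau> ?\<eta> = shift (real (Suc k) * \<tau>) \<omega>"
    by (simp add: shift_shift algebra_simps)
  finally show ?case .
qed

text \<open>The additional \<open>1\<close> leaves room for the geometrically vanishing contribution of the initial state, so
  that tempered sets enter after finitely many steps.\<close>

definition absorbing :: "path \<Rightarrow> state set" where
  "absorbing \<omega> = sublevel (radius \<omega> + 1)"

sublocale dissipative_cocycle "space M" "\<lambda>i. shift (of_int i * \<tau>)" flow absorbing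
proof
  fix \<omega> assume \<omega>: "\<omega> \<in> space M"
  show "shift (of_int 0 * \<tau>) \<omega> = \<omega>"
    using space_C0[OF \<omega>] by (simp add: shift_zero C0_def)
  show "absorbing \<omega> \<noteq> {}"
    unfolding absorbing_def using radius_nonneg[OF \<omega>] by (intro sublevel_nonempty) simp
  show "flow (Suc 0) \<omega> ` absorbing \<omega> \<subseteq> absorbing (shift (of_int 1 * \<tau>) \<omega>)"
  proof -
    have "energy (lift_flow (Suc 0) \<omega> z) \<le> radius (shift \<tau> \<omega>) + 1" if "energy z \<le> radius \<omega> + 1" for z
      using energy_lift_flow_le[OF \<omega> that, of "Suc 0"] decay_bounds by simp
    then show ?thesis
      unfolding absorbing_def flow_sublevel_eq by (auto simp: sublevel_def simp del: lift_flow.simps)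
  qed
qed (auto simp: absorbing_def space_shift shift_shift distrib_right flow_0 flow_add
    continuous_on_flow compact_sublevel)

text \<open>The energy of an initial state in \<open>D\<close> is at most quadratic in the radius of \<open>D\<close>, which grows
  subexponentially towards the past, whereas the contraction is exponential.\<close>

lemma absorbing_pullback:
  assumes D: "D \<in> tempered_sets M" and \<omega>: "\<omega> \<in> space M"
  shows "\<forall>\<^sub>F k in sequentially. flow k (shift (of_int (- int k) * \<tau>) \<omega>) `
    D (shift (of_int (- int k) * \<tau>) \<omega>) \<subseteq> absorbing \<omega>"
proof -
  obtain \<rho> where sub: "\<And>\<omega>. \<omega> \<in> space M \<Longrightarrow> D \<omega> \<subseteq> ball origin (\<rho> \<omega>)"
    and lim: "((\<lambda>t. (1 / t) * ln (max 1 (\<rho> (shift (- t) \<omega>)))) \<longlongrightarrow> (0::real)) at_top"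
    using D \<omega> unfolding tempered_sets_def tempered_def by blast
  define \<xi> where "\<xi> k = shift (- (real k * \<tau>)) \<omega>" for k
  have \<xi>: "\<xi> k \<in> space M" for k
    unfolding \<xi>_def by (rule space_shift[OF \<omega>])
  have "filterlim (\<lambda>k. real k * \<tau>) at_top sequentially"
    using \<tau> by real_asymp
  from filterlim_compose[OF lim this]
  have "\<forall>\<^sub>F k in sequentially. decay ^ k * ((10 + \<kappa>\<^sub>1) * (max 1 (\<rho> (\<xi> k)))\<^sup>2) \<le> 1"
    using decay_bounds \<tau> \<kappa>\<^sub>1 by (intro geometric_beats_subexponential) (auto simp: \<xi>_def)
  then show ?thesis
  proof eventually_elim
    case (elim k)
    have "flow k (\<xi> k) x \<in> absorbing \<omega>" if x: "x \<in> D (\<xi> k)" for x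
    proof -
      obtain z where z: "x = cover z" using surj_cover by blast
      have "x \<in> ball origin (\<rho> (\<xi> k))"
        using sub[OF \<xi>] x by blast
      then have "dist origin (cover z) \<le> max 1 (\<rho> (\<xi> k))" by (auto simp only: z mem_ball max_def split: if_splits intro: less_imp_le)
      then have "energy (J_unlift z) \<le> (10 + \<kappa>\<^sub>1) * (max 1 (\<rho> (\<xi> k)))\<^sup>2"
        by (rule energy_J_unlift_le)
      then have "energy (J_unlift z) \<le> radius (\<xi> k) + (10 + \<kappa>\<^sub>1) * (max 1 (\<rho> (\<xi> k)))\<^sup>2"
        using radius_nonneg[OF \<xi>[of k]] by linarith
      from energy_lift_flow_le[OF \<xi> this, of k]
      have "energy (lift_flow k (\<xi> k) (J_unlift z)) \<le> radius (shift (real k * \<tau>) (\<xi> k)) + 1"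
        using elim by linarith
      also have "shift (real k * \<tau>) (\<xi> k) = \<omega>"
        using space_C0[OF \<omega>] by (simp add: \<xi>_def shift_shift C0_def shift_zero)
      finally show ?thesis
        unfolding absorbing_def sublevel_def z flow_cover by blast
    qed
    then show ?case by (auto simp: \<xi>_def)
  qed
qed


section \<open>Temperedness and measurability\<close>

lemma measurable_radius [measurable]: "(\<lambda>\<omega>. radius (shift s \<omega>)) \<in> borel_measurable M"
proof -
  have "(\<lambda>\<omega>. past_forcing (shift s \<omega>) j) \<in> borel_measurable M" for j
    unfolding past_forcing_def forcing_def shift_def by simp
  then show ?thesis
    unfolding radius_def by (rule borel_measurable_suminf)
qed

text \<open>The attractor lies in the absorbing set, whose radius seen from time \<open>-t\<close> is \<open>O((1 + t)\<^sup>2)\<close> and hence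
  vanishes on the scale \<open>1 / t * ln\<close>.\<close>

lemma tempered_attractor: "tempered M attractor"
proof -
  obtain C where C: "C > 0" "\<And>\<rho>. 0 \<le> \<rho> \<Longrightarrow> sublevel \<rho> \<subseteq> ball origin (C * (1 + \<rho>))"
    using sublevel_subset_ball by blast
  define \<rho> where "\<rho> \<omega> = C * (2 + radius \<omega>)" for \<omega>
  have "radius \<in> borel_measurable M"
    using measurable_radius[of 0]
    by (rule measurable_cong[THEN iffD1, rotated]) (use space_C0 in \<open>simp add: shift_zero C0_def\<close>)
  then have "\<rho> \<in> borel_measurable M"
    unfolding \<rho>_def by measurable
  moreover have "attractor \<omega> \<subseteq> ball origin (\<rho> \<omega>)" if "\<omega> \<in> space M" for \<omega>
  proof -
    have "attractor \<omega> \<subseteq> sublevel (radius \<omega> + 1)"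
      using attractor_subset_B[OF that] by (simp add: absorbing_def)
    also have "\<dots> \<subseteq> ball origin (C * (1 + (radius \<omega> + 1)))"
      using radius_nonneg[OF that] by (intro C) simp
    finally show ?thesis by (simp add: \<rho>_def algebra_simps)
  qed
  moreover have "((\<lambda>t. (1 / t) * ln (max 1 (\<rho> (shift (- t) \<omega>)))) \<longlongrightarrow> (0::real)) at_top"
    if \<omega>: "\<omega> \<in> space M" for \<omega>
  proof -
    obtain K where K: "K \<ge> 0" "\<And>t. 0 \<le> t \<Longrightarrow> radius (shift (- t) \<omega>) \<le> K * (1 + t)\<^sup>2"
      using radius_growth[OF \<omega>] by blast
    define A where "A = 1 + C * (2 + K)"
    have A: "A > 0" using C K by (simp add: A_def add_pos_nonneg)
    have le: "max 1 (\<rho> (shift (- t) \<omega>)) \<le> A * (1 + t)\<^sup>2" if t: "0 < t" for t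
    proof -
      have one: "1 \<le> (1 + t)\<^sup>2" using t by (intro one_le_power) simp
      have "\<rho> (shift (- t) \<omega>) \<le> C * (2 * (1 + t)\<^sup>2 + K * (1 + t)\<^sup>2)"
        unfolding \<rho>_def using C K(2)[of t] t one by (intro mult_left_mono add_mono) auto
      also have "\<dots> = C * (2 + K) * (1 + t)\<^sup>2"
        by (simp add: algebra_simps)
      finally have "\<rho> (shift (- t) \<omega>) \<le> C * (2 + K) * (1 + t)\<^sup>2" .
      moreover have "0 \<le> C * (2 + K) * (1 + t)\<^sup>2"
        using C K by simp
      ultimately show ?thesis
        using one unfolding A_def distrib_right by simp
    qed
    have lim: "((\<lambda>t. (1 / t) * (ln A + 2 * ln (1 + t))) \<longlongrightarrow> (0::real)) at_top"
      by real_asymp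
    show ?thesis
    proof (rule tendsto_sandwich[OF _ _ tendsto_const lim])
      show "\<forall>\<^sub>F t in at_top. 0 \<le> (1 / t) * ln (max 1 (\<rho> (shift (- t) \<omega>)))"
        using eventually_gt_at_top[of 0] by eventually_elim simp
      show "\<forall>\<^sub>F t in at_top. (1 / t) * ln (max 1 (\<rho> (shift (- t) \<omega>))) \<le> (1 / t) * (ln A + 2 * ln (1 + t))"
        using eventually_gt_at_top[of 0]
      proof eventually_elim
        case (elim t)
        have "ln (max 1 (\<rho> (shift (- t) \<omega>))) \<le> ln (A * (1 + t)\<^sup>2)"
          using le[OF elim] by (intro ln_mono) auto
        also have "\<dots> = ln A + 2 * ln (1 + t)"
          using A elim by (simp add: ln_mult ln_realpow)
        finally show ?case
          using elim by (intro mult_left_mono) auto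
      qed
    qed
  qed
  ultimately show ?thesis
    unfolding tempered_def by blast
qed

lemma measurable_lift_flow:
  assumes g: "g \<in> borel_measurable M"
  shows "(\<lambda>\<omega>. lift_flow k (shift s \<omega>) (g \<omega>)) \<in> borel_measurable M"
proof (induction k)
  case (Suc k)
  define f where "f \<omega> = (shift s \<omega> (real (Suc k) * \<tau>) - shift s \<omega> (real k * \<tau>), lift_flow k (shift s \<omega>) (g \<omega>))" for \<omega>
  have "f \<in> borel_measurable M"
    unfolding f_def by (intro borel_measurable_Pair Suc.IH) (simp add: shift_def)
  then have "(\<lambda>\<omega>. (case f \<omega> of (d, z) \<Rightarrow> lift_step d z)) \<in> borel_measurable M"
    by (rule borel_measurable_continuous_on[OF continuous_on_lift_step])
  then show ?case by (simp add: f_def)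
qed (simp add: g)

text \<open>By homogeneity of the energy the lifted sublevel set at level \<open>\<rho>\<close> is \<open>sqrt \<rho>\<close> times the sublevel set \<open>S\<close>
  at level \<open>1\<close>, which does not depend on the noise. The pullback set is thus the image of the fixed set
  \<open>S\<close> under a map that is continuous in the point and measurable in the path, and the distance from it is
  an infimum over a countable dense subset of \<open>S\<close>.\<close>

lemma measurable_infdist_pullback: "(\<lambda>\<omega>. infdist x (pullback n \<omega>)) \<in> borel_measurable M"
  unfolding borel_measurable_iff_less
proof
  fix c :: real
  define \<xi> where "\<xi> = shift (of_int (- int n) * \<tau>)"
  define F where "F \<omega> b = cover (J_lift (lift_flow n (\<xi> \<omega>) (sqrt (radius (\<xi> \<omega>) + 1) *\<^sub>R b)))" for \<omega> b
  define S where "S = {b. energy b \<le> 1}"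
  obtain D where D: "countable D" "D \<subseteq> S" "S \<subseteq> closure D"
    using separable by metis
  have pullback: "pullback n \<omega> = F \<omega> ` S" if \<omega>: "\<omega> \<in> space M" for \<omega>
  proof -
    define r where "r = radius (\<xi> \<omega>) + 1"
    have r: "r > 0"
      using radius_nonneg[OF space_shift[OF \<omega>]] by (simp add: r_def \<xi>_def add_nonneg_pos)
    have "{z. energy z \<le> r} = (\<lambda>b. sqrt r *\<^sub>R b) ` S"
    proof
      show "{z. energy z \<le> r} \<subseteq> (\<lambda>b. sqrt r *\<^sub>R b) ` S"
      proof
        fix z assume "z \<in> {z. energy z \<le> r}"
        then have "(1 / sqrt r) *\<^sub>R z \<in> S"
          using r by (simp add: S_def energy_scaleR power_divide)
        moreover have "z = sqrt r *\<^sub>R ((1 / sqrt r) *\<^sub>R z)"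
          using r by simp
        ultimately show "z \<in> (\<lambda>b. sqrt r *\<^sub>R b) ` S" by blast
      qed
      have "energy (sqrt r *\<^sub>R b) \<le> r" if "b \<in> S" for b
        using r that by (simp add: S_def energy_scaleR mult_left_le)
      then show "(\<lambda>b. sqrt r *\<^sub>R b) ` S \<subseteq> {z. energy z \<le> r}"
        by blast
    qed
    then show ?thesis
      unfolding pullback_def absorbing_def flow_sublevel_eq \<xi>_def[symmetric] r_def[symmetric] F_def
      by (simp add: image_image)
  qed
  have F_cont: "continuous_on UNIV (F \<omega>)" for \<omega>
    unfolding F_def
    by (intro continuous_on_cover continuous_on_compose2[OF continuous_on_J_lift]
        continuous_on_compose2[OF continuous_on_lift_flow] continuous_intros) auto
  have iff: "infdist x (pullback n \<omega>) < c \<longleftrightarrow> (\<exists>b\<in>D. dist x (F \<omega> b) < c)" if \<omega>: "\<omega> \<in> space M" for \<omega>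
  proof
    assume "\<exists>b\<in>D. dist x (F \<omega> b) < c"
    then obtain b where "b \<in> D" "dist x (F \<omega> b) < c" by blast
    moreover from this D(2) have "F \<omega> b \<in> pullback n \<omega>"
      by (auto simp: pullback[OF \<omega>])
    ultimately show "infdist x (pullback n \<omega>) < c"
      using infdist_le[of "F \<omega> b" "pullback n \<omega>" x] by linarith
  next
    assume "infdist x (pullback n \<omega>) < c"
    then have "(INF y\<in>pullback n \<omega>. dist x y) < c"
      using pullback_nonempty[OF \<omega>] by (simp add: infdist_notempty)
    then obtain y where "y \<in> pullback n \<omega>" "dist x y < c"
      using pullback_nonempty[OF \<omega>] by (subst (asm) cINF_less_iff) auto
    then obtain b where b: "b \<in> S" "dist x (F \<omega> b) < c"
      by (auto simp: pullback[OF \<omega>])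
    have "open {b. dist x (F \<omega> b) < c}"
      by (intro open_Collect_less continuous_on_dist continuous_on_const F_cont)
    moreover have "b \<in> closure D \<inter> {b. dist x (F \<omega> b) < c}"
      using b D(3) by blast
    ultimately have "D \<inter> {b. dist x (F \<omega> b) < c} \<noteq> {}"
      using open_Int_closure_eq_empty by blast
    then show "\<exists>b\<in>D. dist x (F \<omega> b) < c" by blast
  qed
  have F_meas: "(\<lambda>\<omega>. dist x (F \<omega> b)) \<in> borel_measurable M" for b
  proof -
    have "(\<lambda>\<omega>. sqrt (radius (\<xi> \<omega>) + 1) *\<^sub>R b) \<in> borel_measurable M"
      unfolding \<xi>_def by measurable
    then have "(\<lambda>\<omega>. lift_flow n (\<xi> \<omega>) (sqrt (radius (\<xi> \<omega>) + 1) *\<^sub>R b)) \<in> borel_measurable M"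
      unfolding \<xi>_def by (rule measurable_lift_flow)
    moreover have "continuous_on UNIV (\<lambda>z. dist x (cover (J_lift z)))"
      by (intro continuous_on_dist continuous_on_const continuous_on_cover continuous_on_J_lift)
    ultimately show ?thesis
      unfolding F_def by (rule borel_measurable_continuous_on[rotated])
  qed
  have "{\<omega> \<in> space M. infdist x (pullback n \<omega>) < c} = (\<Union>b\<in>D. {\<omega> \<in> space M. dist x (F \<omega> b) < c})"
    using iff by auto
  also have "\<dots> \<in> sets M"
    using F_meas by (intro sets.countable_UN' D(1)) (auto simp: borel_measurable_iff_less)
  finally show "{\<omega> \<in> space M. infdist x (pullback n \<omega>) < c} \<in> sets M" .
qed

lemma compact_random_set_attractor: "compact_random_set M attractor"
proof -
  have "(\<lambda>\<omega>. infdist x (attractor \<omega>)) \<in> borel_measurable M" for x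
    unfolding borel_measurable_iff_le
  proof
    fix c :: real
    have [measurable]: "(\<lambda>\<omega>. infdist x (pullback n \<omega>)) \<in> borel_measurable M" for n
      by (rule measurable_infdist_pullback)
    have "infdist x (attractor \<omega>) \<le> c \<longleftrightarrow> (\<forall>n. infdist x (pullback n \<omega>) \<le> c)" if "\<omega> \<in> space M" for \<omega>
      unfolding attractor_def using that
      by (intro infdist_decseq_compact_le_iff compact_pullback decseq_pullback pullback_nonempty)
    then have "{\<omega> \<in> space M. infdist x (attractor \<omega>) \<le> c} =
        {\<omega> \<in> space M. \<forall>n. infdist x (pullback n \<omega>) \<le> c}"
      by auto
    also have "\<dots> \<in> sets M" by measurable
    finally show "{\<omega> \<in> space M. infdist x (attractor \<omega>) \<le> c} \<in> sets M" .
  qed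
  then show ?thesis
    by (simp add: compact_random_set_def compact_attractor attractor_nonempty)
qed

lemma random_attractor_attractor: "random_attractor M \<tau> flow attractor"
  unfolding random_attractor_def
proof (intro conjI allI impI ballI)
  show "attractor \<in> tempered_sets M"
    by (simp add: tempered_sets_def compact_random_set_attractor tempered_attractor)
next
  fix k :: nat and \<omega> assume "\<omega> \<in> space M"
  then show "flow k \<omega> ` attractor \<omega> = attractor (shift (real k * \<tau>) \<omega>)"
    using attractor_invariant[of \<omega> k] by simp
next
  fix D \<omega> assume D: "D \<in> tempered_sets M" and \<omega>: "\<omega> \<in> space M"
  have "D (shift t \<omega>) \<noteq> {}" for t
    using D space_shift[OF \<omega>] by (simp add: tempered_sets_def compact_random_set_def)
  then have "(\<lambda>k. semidist (flow k (shift (of_int (- int k) * \<tau>) \<omega>) ` D (shift (of_int (- int k) * \<tau>) \<omega>))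
      (attractor \<omega>)) \<longlonglongrightarrow> 0"
    by (intro attractor_attracts absorbing_pullback D \<omega>)
  then show "(\<lambda>k. semidist (flow k (shift (- (real k * \<tau>)) \<omega>) ` D (shift (- (real k * \<tau>)) \<omega>))
      (attractor \<omega>)) \<longlonglongrightarrow> 0"
    by simp
qed

end


section \<open>The random attractor of the scheme\<close>

theorem theorem4p4:
  fixes \<zeta>\<^sub>1 \<zeta>\<^sub>2 \<kappa>\<^sub>1 \<kappa>\<^sub>2 \<sigma> \<gamma> \<alpha> :: real
    and P :: "path measure" and \<Omega> :: "path set"
  assumes "\<zeta>\<^sub>1 > 0" "\<zeta>\<^sub>2 > 0" "\<kappa>\<^sub>1 > 0" "\<kappa>\<^sub>2 > 0" "\<sigma> > 0" "\<gamma> \<in> {0<..<1}"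
    and "wiener_measure P"
    and "\<alpha> > 0" "admissible_paths P \<alpha> \<sigma> \<Omega>"
  shows "\<exists>\<tau>\<^sub>0>0. \<forall>\<tau>. 0 < \<tau> \<and> \<tau> < \<tau>\<^sub>0 \<longrightarrow>
           (\<exists>A. random_attractor (restrict_space P \<Omega>) \<tau> (phi \<zeta>\<^sub>1 \<zeta>\<^sub>2 \<kappa>\<^sub>1 \<kappa>\<^sub>2 \<gamma> \<sigma> \<tau>) A)"
proof (intro exI[of _ 1] conjI allI impI)
  (* The threshold 1 is arbitrary: the implicit step contracts the energy for every positive step size. *)
  fix \<tau> :: real assume \<tau>: "0 < \<tau> \<and> \<tau> < 1"
  have space_P: "space P = C0"
    and normal: "\<And>s t. s < t \<Longrightarrow>
      distributed P lborel (\<lambda>\<omega>. \<omega> t - \<omega> s) (\<lambda>x. ennreal (normal_density 0 (sqrt (t - s)) x))"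
    using assms(7) by (auto simp: wiener_measure_def)
  have \<Omega>: "\<Omega> \<in> sets P" "\<And>t. shift t ` \<Omega> = \<Omega>" "\<And>\<omega>. \<omega> \<in> \<Omega> \<Longrightarrow> good_path P \<alpha> \<sigma> \<omega>"
    using assms(9) by (auto simp: admissible_paths_def)
  have sub: "\<Omega> \<subseteq> space P" using \<Omega>(1) by (rule sets.sets_into_space)
  have space: "space (restrict_space P \<Omega>) = \<Omega>"
    using sub by (auto simp: space_restrict_space)
  have incr: "(\<lambda>\<omega>. \<omega> t - \<omega> s) \<in> borel_measurable P" if "s < t" for s t
    using distributed_measurable[OF normal[OF that]] by simp
  interpret driven_scheme \<zeta>\<^sub>1 \<zeta>\<^sub>2 \<kappa>\<^sub>1 \<kappa>\<^sub>2 \<gamma> \<sigma> \<tau> "restrict_space P \<Omega>"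
  proof
    fix \<omega> assume "\<omega> \<in> space (restrict_space P \<Omega>)"
    then have \<omega>: "\<omega> \<in> \<Omega>" by (simp add: space)
    show "\<omega> \<in> C0" using \<omega> sub space_P by auto
    show "shift t \<omega> \<in> space (restrict_space P \<Omega>)" for t
      using \<omega> \<Omega>(2)[of t] by (auto simp: space)
    show "((\<lambda>t. \<omega> t / t) \<longlongrightarrow> 0) at_bot"
      using \<Omega>(3)[OF \<omega>] by (auto simp: good_path_def)
  next
    fix s t :: real
    (* Forward increments are measurable as Gaussian variables; backward ones are their negatives. *)
    consider "s < t" | "s = t" | "t < s" by linarith
    then have "(\<lambda>\<omega>. \<omega> t - \<omega> s) \<in> borel_measurable P"
    proof cases
      case 3
      have "(\<lambda>\<omega>. - (\<omega> s - \<omega> t)) \<in> borel_measurable P"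
        by (intro borel_measurable_uminus incr 3)
      then show ?thesis by simp
    qed (auto intro: incr)
    then show "(\<lambda>\<omega>. \<omega> t - \<omega> s) \<in> borel_measurable (restrict_space P \<Omega>)"
      by (rule measurable_restrict_space1)
  qed (use assms \<tau> in auto)
  show "\<exists>A. random_attractor (restrict_space P \<Omega>) \<tau> (phi \<zeta>\<^sub>1 \<zeta>\<^sub>2 \<kappa>\<^sub>1 \<kappa>\<^sub>2 \<gamma> \<sigma> \<tau>) A"
    using random_attractor_attractor unfolding flow_def by blast
qed simp

end
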